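(* Let $G(s)$ and $\bar G(s)$ be $m\times m$ transfer function matrices. Suppose that $\bar G(s)$ is strictly negative imaginary (SNI) and that $G(s)$ is strictly proper and negative imaginary (NI) with $G_1=0$ and $G_2\neq0$. Suppose also that $\mathcal N(G_2)\subseteq\mathcal N(G_0^T)$, where $\mathcal N(\cdot)$ denotes the null space of a matrix. Let $G_2=JJ^T$ with $J$ of full column rank. Then the positive-feedback interconnection $[G(s),\bar G(s)]$ is internally stable if and only if $$J^T\bar G(0)J<0 .$$
   Context: Conventions. Transfer function matrices are square, real, rational and proper, $G(s)=C(sI-A)^{-1}B+D$ with real $A,B,C,D$; $G$ is strictly proper if $G(\infty)=D=0$. $M^*$ is the conjugate transpose; $>0,\ \ge 0,\ <0$ denote (Hermitian/symmetric) positive definiteness, positive semidefiniteness, negative definiteness. NI. A square $G(s)$ is NI if: (1) $G(s)$ has no pole in $\mathrm{Re}[s]>0$; (2) for all $\omega>0$ such that $j\omega$ is not a pole of $G(s)$, $j(G(j\omega)-G(j\omega)^* )\ge 0$; (3) if $s=j\omega_0$ with $\omega_0>0$ is a pole of $G(s)$, it is a simple pole and $K=\lim_{s\to j\omega_0}(s-j\omega_0)jG(s)$ is Hermitian and positive semidefinite; (4) if $s=0$ is a pole of $G(s)$, then $\lim_{s\to0}s^kG(s)=0$ for all $k\ge 3$ and $\lim_{s\to 0}s^2G(s)$ is Hermitian and positive semidefinite. SNI. A square $\bar G(s)$ is SNI if it has no pole in $\mathrm{Re}[s]\ge 0$ and $j(\bar G(j\omega)-\bar G(j\omega)^* )>0$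 for all $\omega>0$. Internal stability. Let $G$ have minimal realization $(A,B,C,D)$ and $\bar G$ minimal realization $(\bar A,\bar B,\bar C,\bar D)$ with $I-D\bar D$ nonsingular. The positive feedback interconnection $[G(s),\bar G(s)]$ is internally stable if $$\breve A=\begin{bmatrix}A+B\bar D(I-D\bar D)^{-1}C & B\bar C+B\bar D(I-D\bar D)^{-1}D\bar C\\ \bar B(I-D\bar D)^{-1}C & \bar A+\bar B(I-D\bar D)^{-1}D\bar C\end{bmatrix}$$ is Hurwitz (all eigenvalues in the open left half plane). Matrices attached to an NI $G$: $G_2=\lim_{s\to0}s^2G(s)$, $G_1=\lim_{s\to0}s\left(G(s)-\frac{G_2}{s^2}\right)$, $G_0=\lim_{s\to0}\left(G(s)-\frac{G_2}{s^2}-\frac{G_1}{s}\right)$. For NI $G$, $G_2\ge0$, so if $G_2\neq0$ it can be decomposed as $G_2=JJ^T$ with $J$ real of full column rank. *)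

theory Defs
  imports "HOL-Complex_Analysis.Complex_Analysis"
begin

abbreviation cmat :: "real^'n^'m \<Rightarrow> complex^'n^'m" where
  "cmat \<equiv> map_matrix complex_of_real"

abbreviation cscale :: "complex \<Rightarrow> complex^'n^'m \<Rightarrow> complex^'n^'m" where
  "cscale c \<equiv> map_matrix ((*) c)"

definition ctranspose :: "complex^'n^'m \<Rightarrow> complex^'m^'n" where
  "ctranspose M = (\<chi> i j. cnj (M $ j $ i))"

definition hermitian :: "complex^'n^'n \<Rightarrow> bool" where
  "hermitian M \<longleftrightarrow> ctranspose M = M"

text \<open>For Hermitian \<open>M\<close> the form \<open>x\<^sup>* M x\<close> is real, so taking its real part loses nothing.\<close>

definition herm_form :: "complex^'n^'n \<Rightarrow> complex^'n \<Rightarrow> real" where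
  "herm_form M x = Re (\<Sum>i\<in>UNIV. cnj (x $ i) * (M *v x) $ i)"

definition pos_def :: "complex^'n^'n \<Rightarrow> bool" where
  "pos_def M \<longleftrightarrow> hermitian M \<and> (\<forall>x. x \<noteq> 0 \<longrightarrow> herm_form M x > 0)"

definition pos_semidef :: "complex^'n^'n \<Rightarrow> bool" where
  "pos_semidef M \<longleftrightarrow> hermitian M \<and> (\<forall>x. herm_form M x \<ge> 0)"

definition neg_def :: "complex^'n^'n \<Rightarrow> bool" where
  "neg_def M \<longleftrightarrow> hermitian M \<and> (\<forall>x. x \<noteq> 0 \<longrightarrow> herm_form M x < 0)"

definition null_space :: "complex^'n^'m \<Rightarrow> (complex^'n) set" where
  "null_space M = {x. M *v x = 0}"

definition hurwitz :: "real^'n^'n \<Rightarrow> bool" where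
  "hurwitz A \<longleftrightarrow> (\<forall>l v. v \<noteq> 0 \<and> cmat A *v v = l *s v \<longrightarrow> Re l < 0)"

text \<open>
  A transfer function matrix is a function \<open>G :: complex \<Rightarrow> complex^'m^'m\<close>. A realization
  prescribes it as \<open>C (s I - A)\<^sup>-\<^sup>1 B + D\<close> off the spectrum of \<open>A\<close>; its values on the spectrum of \<open>A\<close>
  are left open. For a minimal realization the spectrum is exactly the set of poles of \<open>G\<close>.
\<close>

definition realization ::
  "(complex \<Rightarrow> complex^'m^'m) \<Rightarrow> real^'n^'n \<Rightarrow> real^'m^'n \<Rightarrow> real^'n^'m \<Rightarrow> real^'m^'m \<Rightarrow> bool" where
  "realization G A B C D \<longleftrightarrow>
     (\<forall>s. invertible (mat s - cmat A) \<longrightarrow>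
        G s = cmat C ** matrix_inv (mat s - cmat A) ** cmat B + cmat D)"

text \<open>
  Minimality compares state dimensions, so realizations with an arbitrary number \<open>k\<close> of states
  (including 0) have to be quantified over inside one formula; a dimension given by a type does not
  allow this. Hence their state space is indexed by the natural numbers below \<open>k\<close>. The matrix
  \<open>X = (s I - A)\<^sup>-\<^sup>1 B\<close> is described as the solution of \<open>(s I - A) X = B\<close>, which is unique for all large
  \<open>s\<close>; agreement for all large \<open>s\<close> is equality of rational functions.
\<close>

definition has_realization_of_order :: "(complex \<Rightarrow> complex^'m^'m) \<Rightarrow> nat \<Rightarrow> bool" where
  "has_realization_of_order G k \<longleftrightarrow>
     (\<exists>(A :: nat \<Rightarrow> nat \<Rightarrow> real) (B :: nat \<Rightarrow> 'm \<Rightarrow> real) (C :: 'm \<Rightarrow> nat \<Rightarrow> real) (D :: real^'m^'m).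
        \<forall>\<^sub>F s in at_infinity. \<exists>X :: nat \<Rightarrow> 'm \<Rightarrow> complex.
          (\<forall>i<k. \<forall>q. s * X i q - (\<Sum>j<k. of_real (A i j) * X j q) = of_real (B i q)) \<and>
          (\<forall>p q. G s $ p $ q = (\<Sum>i<k. of_real (C p i) * X i q) + of_real (D $ p $ q)))"

definition minimal_realization ::
  "(complex \<Rightarrow> complex^'m^'m) \<Rightarrow> real^'n^'n \<Rightarrow> real^'m^'n \<Rightarrow> real^'n^'m \<Rightarrow> real^'m^'m \<Rightarrow> bool" where
  "minimal_realization G A B C D \<longleftrightarrow>
     realization G A B C D \<and> (\<forall>k. has_realization_of_order G k \<longrightarrow> CARD('n) \<le> k)"

definition has_pole :: "(complex \<Rightarrow> complex^'m^'m) \<Rightarrow> complex \<Rightarrow> bool" where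
  "has_pole G z \<longleftrightarrow> (\<exists>p q. is_pole (\<lambda>s. G s $ p $ q) z)"

definition negative_imaginary :: "(complex \<Rightarrow> complex^'m^'m) \<Rightarrow> bool" where
  "negative_imaginary G \<longleftrightarrow>
     (\<forall>s. Re s > 0 \<longrightarrow> \<not> has_pole G s) \<and>
     (\<forall>w>0. \<not> has_pole G (\<i> * of_real w) \<longrightarrow>
        pos_semidef (cscale \<i> (G (\<i> * of_real w) - ctranspose (G (\<i> * of_real w))))) \<and>
     \<comment> \<open>existence of the limit \<open>K\<close> says that the pole is simple\<close>
     (\<forall>w>0. has_pole G (\<i> * of_real w) \<longrightarrow>
        (\<exists>K. ((\<lambda>s. cscale ((s - \<i> * of_real w) * \<i>) (G s)) \<longlongrightarrow> K) (at (\<i> * of_real w)) \<and>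
             pos_semidef K)) \<and>
     (has_pole G 0 \<longrightarrow>
        (\<forall>k\<ge>3. ((\<lambda>s. cscale (s ^ k) (G s)) \<longlongrightarrow> 0) (at 0)) \<and>
        (\<exists>K. ((\<lambda>s. cscale (s ^ 2) (G s)) \<longlongrightarrow> K) (at 0) \<and> pos_semidef K))"

definition strictly_negative_imaginary :: "(complex \<Rightarrow> complex^'m^'m) \<Rightarrow> bool" where
  "strictly_negative_imaginary G \<longleftrightarrow>
     (\<forall>s. Re s \<ge> 0 \<longrightarrow> \<not> has_pole G s) \<and>
     (\<forall>w>0. pos_def (cscale \<i> (G (\<i> * of_real w) - ctranspose (G (\<i> * of_real w)))))"

definition coeff2 :: "(complex \<Rightarrow> complex^'m^'m) \<Rightarrow> complex^'m^'m" where
  "coeff2 G = Lim (at 0) (\<lambda>s. cscale (s ^ 2) (G s))"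

definition coeff1 :: "(complex \<Rightarrow> complex^'m^'m) \<Rightarrow> complex^'m^'m" where
  "coeff1 G = Lim (at 0) (\<lambda>s. cscale s (G s - cscale (1 / s ^ 2) (coeff2 G)))"

definition coeff0 :: "(complex \<Rightarrow> complex^'m^'m) \<Rightarrow> complex^'m^'m" where
  "coeff0 G = Lim (at 0) (\<lambda>s. G s - cscale (1 / s ^ 2) (coeff2 G) - cscale (1 / s) (coeff1 G))"

definition block_matrix ::
  "'a^'n^'n \<Rightarrow> 'a^'k^'n \<Rightarrow> 'a^'n^'k \<Rightarrow> 'a^'k^'k \<Rightarrow> 'a^('n + 'k)^('n + 'k)" where
  "block_matrix P Q R S =
     (\<chi> i j. case i of
        Inl a \<Rightarrow> (case j of Inl b \<Rightarrow> P $ a $ b | Inr b \<Rightarrow> Q $ a $ b)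
      | Inr a \<Rightarrow> (case j of Inl b \<Rightarrow> R $ a $ b | Inr b \<Rightarrow> S $ a $ b))"

definition closed_loop_matrix ::
  "real^'n^'n \<Rightarrow> real^'m^'n \<Rightarrow> real^'n^'m \<Rightarrow> real^'m^'m \<Rightarrow>
   real^'k^'k \<Rightarrow> real^'m^'k \<Rightarrow> real^'k^'m \<Rightarrow> real^'m^'m \<Rightarrow> real^('n + 'k)^('n + 'k)" where
  "closed_loop_matrix A B C D A' B' C' D' =
     (let E = matrix_inv (mat 1 - D ** D') in
      block_matrix
        (A + B ** D' ** E ** C) (B ** C' + B ** D' ** E ** D ** C')
        (B' ** E ** C)          (A' + B' ** E ** D ** C'))"

text \<open>
  Internal stability of the positive feedback interconnection, expressed through given
  minimal realizations of its two blocks.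
\<close>

definition internally_stable ::
  "real^'n^'n \<Rightarrow> real^'m^'n \<Rightarrow> real^'n^'m \<Rightarrow> real^'m^'m \<Rightarrow>
   real^'k^'k \<Rightarrow> real^'m^'k \<Rightarrow> real^'k^'m \<Rightarrow> real^'m^'m \<Rightarrow> bool" where
  "internally_stable A B C D A' B' C' D' \<longleftrightarrow>
     invertible (mat 1 - D ** D') \<and> hurwitz (closed_loop_matrix A B C D A' B' C' D')"

end

theory Submission
  imports Defs
begin

text \<open>
  On a closed loop mode \<open>s\<close> with \<open>y = G(s)u\<close> and \<open>u = G'(s)y\<close> two positive real functions meet: \<open>s G(s)\<close>,
  because \<open>G\<close> is NI, and \<open>(G'(0) - G'(s))/s\<close>, because \<open>G'\<close> is SNI. In \<open>Re s > 0\<close> they give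
  \<open>Re (s u\<^sup>*y) \<ge> 0\<close> and \<open>Re s (y\<^sup>*G'(0)y) \<ge> Re (s u\<^sup>*y)\<close>, hence \<open>y\<^sup>*G'(0)y \<ge> 0\<close>. The null space condition forces
  \<open>y\<close> into the range of \<open>J\<close>: a vector \<open>w\<close> annihilating \<open>G\<^sub>2\<close> and \<open>G\<^sub>0\<close> gives \<open>s w\<^sup>*G(s)w\<close> a double zero at the
  boundary point 0, which a positive real function can have only if it vanishes. So \<open>J\<^sup>TG'(0)J < 0\<close>
  excludes such modes; on the imaginary axis strictness of the SNI property does so, and at 0 the
  equation \<open>J\<^sup>Tu = 0\<close>.

  Conversely, if the loop is stable, then the transfer function \<open>T\<close> from an input \<open>r\<close> added to \<open>u\<close> to
  the output \<open>y\<close> has no poles in \<open>Re s \<ge> 0\<close>, and \<open>s T(s)\<close> is positive real, so \<open>r\<^sup>*T(0)r\<close> has nonnegative real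
  part. At 0 one has \<open>T(0)r = Jz\<close> with \<open>J\<^sup>TG'(0)J z = - J\<^sup>Tr\<close>; as \<open>J\<^sup>T\<close> is onto, \<open>J\<^sup>TG'(0)J\<close> is negative
  semidefinite and onto, i.e. negative definite.
\<close>

subsection \<open>Positivity in the right half plane\<close>

lemma punctured_holomorphicE:
  assumes "f holomorphic_on -S" "closed S" "\<forall>\<^sub>F s in at p. s \<notin> S"
  obtains r where "r > 0" "f holomorphic_on ball p r - {p}" "\<And>s. s \<in> ball p r - {p} \<Longrightarrow> s \<notin> S"
proof -
  obtain r where r: "r > 0" "\<And>s. s \<noteq> p \<Longrightarrow> dist s p < r \<Longrightarrow> s \<notin> S"
    using assms(3) unfolding eventually_at by auto
  have "ball p r - {p} \<subseteq> -S" using r(2) by (auto simp: dist_commute)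
  then show ?thesis using that[OF r(1)] assms(1) holomorphic_on_subset by blast
qed

text \<open>\<open>(s - p) * f s\<close> extends holomorphically across \<open>p\<close> with value
  \<open>k\<close>. The remainder is the difference quotient of that extension, so its limit is a
  derivative.\<close>

lemma simple_pole_remainder_tendsto:
  fixes f :: "complex \<Rightarrow> complex"
  assumes "f holomorphic_on ball p r - {p}" "r > 0"
    and lim: "((\<lambda>s. (s - p) * f s) \<longlongrightarrow> k) (at p)"
  obtains L where "((\<lambda>s. f s - k / (s - p)) \<longlongrightarrow> L) (at p)"
proof -
  define F where "F = (\<lambda>s. if s = p then k else (s - p) * f s)"
  have "F holomorphic_on ball p r"
    unfolding F_def
    by (rule removable_singularity) (use assms in \<open>auto intro!: holomorphic_intros\<close>)
  then have "(F has_field_derivative deriv F p) (at p)"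
    using assms(2) by (intro holomorphic_derivI[of _ "ball p r"]) auto
  then have "((\<lambda>s. (F s - F p) / (s - p)) \<longlongrightarrow> deriv F p) (at p)"
    by (simp add: has_field_derivative_iff)
  moreover have "\<forall>\<^sub>F s in at p. (F s - F p) / (s - p) = f s - k / (s - p)"
    by (auto simp: eventually_at_filter F_def divide_simps)
  ultimately have "((\<lambda>s. f s - k / (s - p)) \<longlongrightarrow> deriv F p) (at p)"
    using tendsto_cong by fast
  then show ?thesis by (rule that)
qed

lemma Re_tendsto_nonneg_imaginary_axis:
  fixes f :: "complex \<Rightarrow> complex"
  assumes "(f \<longlongrightarrow> L) (at p)" "Re p = 0"
    and ev: "\<forall>\<^sub>F s in at p. Re s = 0 \<longrightarrow> Re (f s) \<ge> 0"
  shows "Re L \<ge> 0"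
proof -
  define g where "g = (\<lambda>t::real. p + \<i> * of_real t)"
  have lim: "filterlim g (at p) (at_right 0)"
  proof (rule filterlim_atI)
    have "(g \<longlongrightarrow> p + \<i> * of_real 0) (at_right 0)"
      unfolding g_def by (intro tendsto_intros)
    then show "(g \<longlongrightarrow> p) (at_right 0)" by simp
    show "\<forall>\<^sub>F x in at_right 0. g x \<noteq> p"
      unfolding g_def by (auto simp: eventually_at_filter)
  qed
  have "\<forall>\<^sub>F t in at_right 0. Re (f (g t)) \<ge> 0"
    using eventually_compose_filterlim[OF ev lim]
    by eventually_elim (use assms(2) in \<open>auto simp: g_def\<close>)
  moreover have "((\<lambda>t. Re (f (g t))) \<longlongrightarrow> Re L) (at_right 0)"
    using filterlim_compose[OF assms(1) lim] by (intro tendsto_Re)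
  ultimately show ?thesis
    using tendsto_lowerbound trivial_limit_at_right_real by blast
qed

lemma Re_tendsto_nonneg_imaginary_axis_at_infinity:
  fixes f :: "complex \<Rightarrow> complex"
  assumes "(f \<longlongrightarrow> L) at_infinity"
    and ev: "\<forall>\<^sub>F s in at_infinity. Re s = 0 \<longrightarrow> Re (f s) \<ge> 0"
  shows "Re L \<ge> 0"
proof -
  define g where "g = (\<lambda>t::real. \<i> * of_real t)"
  have lim: "filterlim g at_infinity at_top"
    unfolding g_def
    by (intro tendsto_mult_filterlim_at_infinity[of _ \<i>] tendsto_const
        filterlim_compose[OF filterlim_of_real_at_infinity] filterlim_at_top_imp_at_infinity filterlim_ident) auto
  have "\<forall>\<^sub>F t in at_top. Re (f (g t)) \<ge> 0"
    using eventually_compose_filterlim[OF ev lim]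
    by eventually_elim (auto simp: g_def)
  moreover have "((\<lambda>t. Re (f (g t))) \<longlongrightarrow> Re L) at_top"
    using filterlim_compose[OF assms(1) lim] by (intro tendsto_Re)
  ultimately show ?thesis
    using tendsto_lowerbound trivial_limit_at_top_linorder by blast
qed

lemma Re_divide_nonneg:
  fixes k :: real
  assumes "k \<ge> 0" "Re z \<ge> 0"
  shows "Re (of_real k / z) \<ge> 0"
  using assms by (simp add: Re_divide)

text \<open>A maximum principle: if \<open>Re f\<close> were below \<open>-e\<close> somewhere, then \<open>\<bar>exp (-f)\<bar>\<close> would exceed
  its boundary value \<open>exp e\<close> inside the bounded open set where \<open>Re f < -e\<close>; the boundary conditions
  keep that set away from the imaginary axis.\<close>

lemma Re_nonneg_right_half_plane:
  fixes f :: "complex \<Rightarrow> complex"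
  assumes hol: "f holomorphic_on -S" and cl: "closed S"
    and iso: "\<And>p. \<forall>\<^sub>F s in at p. s \<notin> S"
    and rhp: "\<And>s. Re s > 0 \<Longrightarrow> s \<notin> S"
    and axis: "\<And>s. Re s = 0 \<Longrightarrow> s \<notin> S \<Longrightarrow> Re (f s) \<ge> 0"
    and resid: "\<And>p. Re p = 0 \<Longrightarrow> \<exists>k::real. k \<ge> 0 \<and> ((\<lambda>s. (s - p) * f s) \<longlongrightarrow> of_real k) (at p)"
    and lim: "(f \<longlongrightarrow> L) at_infinity"
    and infS: "\<forall>\<^sub>F s in at_infinity. s \<notin> S"
    and z: "Re z > 0"
  shows "Re (f z) \<ge> 0"
proof (rule ccontr)
  assume neg: "\<not> Re (f z) \<ge> 0"
  \<comment> \<open>Half the violation: \<open>Re (f z) = -2 * e\<close> puts \<open>z\<close>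
    strictly inside \<open>U\<close> and leaves a margin \<open>e\<close> for the boundary
    behaviour.\<close>
  define e where "e = - Re (f z) / 2"
  have e: "e > 0" "Re (f z) < -e" using neg by (auto simp: e_def)
  define U where "U = {s. Re s > 0 \<and> Re (f s) < -e}"
  \<comment> \<open>The pole term \<open>k / (s - p)\<close> has real part zero on the axis, so the
    sign of \<open>Re f\<close> there passes to the limit of the remainder. Inside the half plane
    \<open>k \<ge> 0\<close> makes its real part nonnegative.\<close>
  have bdry: "\<exists>r>0. \<forall>s. dist s p < r \<longrightarrow> Re s > 0 \<longrightarrow> Re (f s) > -e" if p: "Re p = 0" for p
  proof -
    obtain k where k: "k \<ge> 0" "((\<lambda>s. (s - p) * f s) \<longlongrightarrow> of_real k) (at p)"
      using resid[OF p] by auto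
    obtain r where r: "r > 0" "f holomorphic_on ball p r - {p}" "\<And>s. s \<in> ball p r - {p} \<Longrightarrow> s \<notin> S"
      using punctured_holomorphicE[OF hol cl iso] by blast
    obtain M where M: "((\<lambda>s. f s - of_real k / (s - p)) \<longlongrightarrow> M) (at p)"
      using simple_pole_remainder_tendsto[OF r(2,1) k(2)] by blast
    have "\<forall>\<^sub>F s in at p. s \<in> ball p r - {p}"
      using r(1) by (intro eventually_at_in_open) auto
    then have "\<forall>\<^sub>F s in at p. Re s = 0 \<longrightarrow> Re (f s - of_real k / (s - p)) \<ge> 0"
    proof eventually_elim
      case (elim s)
      have "Re (f s) \<ge> 0" if "Re s = 0" using axis[OF that] r(3)[OF elim] by simp
      moreover have "Re (of_real k / (s - p)) = 0" if "Re s = 0" using that p by (simp add: Re_divide)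
      ultimately show ?case by simp
    qed
    then have "Re M \<ge> 0" by (rule Re_tendsto_nonneg_imaginary_axis[OF M p])
    have "\<forall>\<^sub>F s in at p. Re (f s - of_real k / (s - p)) > -e"
      by (rule order_tendstoD(1)[OF tendsto_Re[OF M]]) (use \<open>Re M \<ge> 0\<close> e in linarith)
    then obtain d where d: "d > 0"
      "\<And>s. s \<noteq> p \<Longrightarrow> dist s p < d \<Longrightarrow> Re (f s - of_real k / (s - p)) > -e"
      unfolding eventually_at by auto
    have "Re (f s) > -e" if "dist s p < d" "Re s > 0" for s
    proof -
      have "s \<noteq> p" using that p by auto
      moreover have "Re (of_real k / (s - p)) \<ge> 0" using Re_divide_nonneg[OF k(1), of "s - p"] that p by simp
      ultimately show ?thesis using d(2)[of s] that by simp
    qed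
    then show ?thesis using d(1) by blast
  qed
  have "Re L \<ge> 0"
    by (rule Re_tendsto_nonneg_imaginary_axis_at_infinity[OF lim])
       (use infS axis in \<open>auto elim: eventually_mono\<close>)
  then have "\<forall>\<^sub>F s in at_infinity. Re (f s) > -e"
    by (intro order_tendstoD(1)[OF tendsto_Re[OF lim]]) (use e in linarith)
  then obtain b where b: "\<And>s. norm s \<ge> b \<Longrightarrow> Re (f s) > -e"
    unfolding eventually_at_infinity by auto
  have "bounded U"
    unfolding bounded_iff
  proof (intro exI ballI)
    fix s assume "s \<in> U"
    then show "norm s \<le> b" using b[of s] by (cases "norm s \<le> b") (auto simp: U_def)
  qed
  have clU: "Re s > 0" if s: "s \<in> closure U" for s
  proof (rule ccontr)
    assume "\<not> Re s > 0"
    moreover have "closure U \<subseteq> {s. Re s \<ge> 0}"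
      by (rule closure_minimal) (auto simp: U_def closed_halfspace_Re_ge)
    ultimately have "Re s = 0" using s by (metis (no_types, lifting) mem_Collect_eq order_antisym_conv subsetD linorder_not_less)
    then obtain r where r: "r > 0" "\<forall>t. dist t s < r \<longrightarrow> Re t > 0 \<longrightarrow> Re (f t) > -e"
      using bdry by blast
    obtain t where "t \<in> U" "dist t s < r" using s r(1) by (meson closure_approachable)
    then show False using r(2)[rule_format, of t] by (simp add: U_def)
  qed
  have holR: "f holomorphic_on {s. Re s > 0}"
    by (rule holomorphic_on_subset[OF hol]) (use rhp in auto)
  then have contR: "continuous_on {s. Re s > 0} f" by (rule holomorphic_on_imp_continuous_on)
  have opR: "open {s. Re s > 0}" by (rule open_halfspace_Re_gt)
  have "U = {s \<in> {s. Re s > 0}. Re (f s) \<in> {..< -e}}" by (auto simp: U_def)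
  then have "open U"
    using continuous_open_preimage[OF continuous_on_Re[OF contR] opR open_lessThan, of "-e"]
    by (simp add: vimage_def Int_def)
  have holU: "(\<lambda>s. exp (- f s)) holomorphic_on interior U"
    by (intro holomorphic_intros holomorphic_on_subset[OF holR])
       (use interior_subset in \<open>force simp: U_def\<close>)
  have contU: "continuous_on (closure U) (\<lambda>s. exp (- f s))"
    by (intro continuous_intros continuous_on_subset[OF contR]) (use clU in auto)
  \<comment> \<open>The left side equals \<open>exp (2 * e)\<close>, which yields the
    contradiction.\<close>
  have "norm (exp (- f z)) \<le> exp e"
  proof (rule maximum_modulus_frontier[OF holU contU \<open>bounded U\<close>])
    show "z \<in> U" using z e by (simp add: U_def)
    fix s assume s: "s \<in> frontier U"
    then have "s \<notin> U" "s \<in> closure U" using \<open>open U\<close> by (auto simp: frontier_def interior_open)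
    then have "Re (f s) \<ge> -e" using clU[of s] by (simp add: U_def)
    then show "norm (exp (- f s)) \<le> exp e" by simp
  qed
  then show False using e by simp
qed

text \<open>A zero of order \<open>k \<ge> 2\<close> at the boundary is impossible: \<open>z\<^sup>k\<close> turns the half plane by at
  least a full circle, so some direction in it is mapped close to the negative axis.\<close>

lemma Re_nonneg_double_boundary_zero:
  fixes f :: "complex \<Rightarrow> complex"
  assumes hol: "f holomorphic_on ball 0 r - {0}" and r: "r > 0"
    and lim: "((\<lambda>s. f s / s) \<longlongrightarrow> 0) (at 0)"
    and pos: "\<And>s. s \<in> ball 0 r \<Longrightarrow> Re s > 0 \<Longrightarrow> Re (f s) \<ge> 0"
    and z: "z \<in> ball 0 r - {0}"
  shows "f z = 0"
proof (rule ccontr)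
  assume nz: "f z \<noteq> 0"
  define g where "g = (\<lambda>s. if s = 0 then 0 else f s / s)"
  have holg: "g holomorphic_on ball 0 r"
    unfolding g_def by (rule removable_singularity) (use hol lim in \<open>auto intro!: holomorphic_intros\<close>)
  have "g z \<noteq> 0" using z nz by (simp add: g_def)
  moreover have g0: "g 0 = 0" by (simp add: g_def)
  ultimately have "\<not> g constant_on ball 0 r"
    using z r unfolding constant_on_def by (metis DiffD1 centre_in_ball)
  then obtain h q n where h: "0 < n" "0 < q" "ball 0 q \<subseteq> ball (0::complex) r" "h holomorphic_on ball 0 q"
      "\<And>w. w \<in> ball 0 q \<Longrightarrow> g w = (w - 0)^n * h w" "\<And>w. w \<in> ball 0 q \<Longrightarrow> h w \<noteq> 0"
    using holomorphic_factor_zero_nonconstant[OF holg open_ball connected_ball _ g0] r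
    by (metis centre_in_ball)
  \<comment> \<open>One more than the order of \<open>g = f / s\<close>, so that
    \<open>f s = s ^ k * h s\<close>.\<close>
  define k where "k = Suc n"
  have k: "k \<ge> 2" using h(1) by (simp add: k_def)
  define a where "a = Arg (h 0)"
  have a: "-pi < a" "a \<le> pi" by (auto simp: a_def Arg_bounded)
  have h0: "h 0 = of_real (norm (h 0)) * cis a"
    unfolding a_def by (metis Arg_eq cis_conv_exp of_real_mult mult.commute h(2) h(6) centre_in_ball)
  \<comment> \<open>Along the ray of direction \<open>t\<close> the leading term
    \<open>s ^ k * h 0\<close> has argument 3*pi/4 or -3*pi/4, whichever has the sign of
    \<open>a\<close>. This keeps \<open>\<bar>k * t\<bar>\<close> within 3*pi/4, so for
    \<open>k \<ge> 2\<close> the ray stays in the right half plane.\<close>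
  define t where "t = ((if a \<ge> 0 then 3*pi/4 else - (3*pi/4)) - a) / real k"
  have kt: "real k * t + a = (if a \<ge> 0 then 3*pi/4 else - (3*pi/4))" using k by (simp add: t_def)
  have "\<bar>real k * t\<bar> \<le> 3*pi/4" using kt a by (auto split: if_splits)
  moreover have "2 * \<bar>t\<bar> \<le> \<bar>real k * t\<bar>" using k by (simp add: abs_mult mult_right_mono)
  ultimately have "\<bar>t\<bar> < pi/2" using pi_gt_zero by linarith
  then have cost: "cos t > 0" by (intro cos_gt_zero_pi) auto
  have cneg: "cos (real k * t + a) < 0"
  proof -
    have "cos (3*pi/4) < 0"
      by (rule cos_lt_zero_pi) (use pi_gt_zero in linarith)+
    then show ?thesis by (simp add: kt)
  qed
  have contH: "continuous (at 0) h"
    using h(2,4) by (meson centre_in_ball continuous_on_eq_continuous_at holomorphic_on_imp_continuous_on open_ball)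
  have "((\<lambda>x::real. h (of_real x * cis t)) \<longlongrightarrow> h 0) (at_right 0)"
  proof (rule isCont_tendsto_compose[OF contH])
    have "((\<lambda>x::real. of_real x * cis t) \<longlongrightarrow> of_real 0 * cis t) (at_right 0)" by (intro tendsto_intros)
    then show "((\<lambda>x::real. of_real x * cis t) \<longlongrightarrow> 0) (at_right 0)" by simp
  qed
  then have limr: "((\<lambda>x::real. Re (cis (real k * t) * h (of_real x * cis t))) \<longlongrightarrow> Re (cis (real k * t) * h 0)) (at_right 0)"
    by (intro tendsto_intros)
  have "\<forall>\<^sub>F x in at_right (0::real). x < q \<and> x > 0"
    using h(2) eventually_at_right_field by auto
  then have "\<forall>\<^sub>F x in at_right (0::real). Re (cis (real k * t) * h (of_real x * cis t)) \<ge> 0"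
  proof eventually_elim
    case (elim x)
    define s where "s = of_real x * cis t"
    have s: "s \<in> ball 0 q" "s \<noteq> 0" "Re s > 0"
      using elim cost by (auto simp: s_def norm_mult)
    then have "f s = s ^ k * h s" using h(5)[of s] by (simp add: g_def k_def field_simps)
    also have "s ^ k = of_real (x^k) * cis (real k * t)"
      by (simp add: s_def power_mult_distrib Complex.DeMoivre)
    finally have "f s = of_real (x^k) * (cis (real k * t) * h s)" by (simp only: mult.assoc)
    then have "Re (f s) = x^k * Re (cis (real k * t) * h s)"
      by (simp del: of_real_power)
    moreover have "Re (f s) \<ge> 0" using pos s h(3) by blast
    moreover have "x ^ k > 0" using elim by simp
    ultimately show ?case unfolding s_def by (metis zero_le_mult_iff not_less)
  qed
  then have "Re (cis (real k * t) * h 0) \<ge> 0"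
    using limr tendsto_lowerbound trivial_limit_at_right_real by blast
  moreover have "Re (cis (real k * t) * h 0) = norm (h 0) * cos (real k * t + a)"
    by (subst h0) (simp add: cos_add algebra_simps)
  moreover have "norm (h 0) > 0" using h(2,6) by auto
  then have "norm (h 0) * cos (real k * t + a) < 0" using cneg by (rule mult_pos_neg)
  ultimately show False by linarith
qed

subsection \<open>Complex vectors and real matrices\<close>

no_notation fps_nth (infixl "$" 75)

text \<open>Conjugate linear in the first argument, as in \<open>herm_form\<close>; the complex
  value is kept because it gets multiplied by \<open>s\<close>.\<close>

definition sip :: "complex^'n \<Rightarrow> complex^'n \<Rightarrow> complex" where
  "sip x y = (\<Sum>i\<in>UNIV. cnj (x $ i) * y $ i)"

definition vcnj :: "complex^'n \<Rightarrow> complex^'n" where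
  "vcnj x = (\<chi> i. cnj (x $ i))"

definition cvec :: "real^'n \<Rightarrow> complex^'n" where
  "cvec x = (\<chi> i. of_real (x $ i))"

lemma sip_simps:
  "sip x (y + z) = sip x y + sip x z" "sip (x + y) z = sip x z + sip y z"
  "sip x (y - z) = sip x y - sip x z" "sip (x - y) z = sip x z - sip y z"
  "sip x (c *s y) = c * sip x y" "sip (c *s x) y = cnj c * sip x y"
  "sip x 0 = 0" "sip 0 x = 0"
  by (simp_all add: sip_def algebra_simps sum.distrib sum_subtractf sum_distrib_left)

lemma cnj_sip: "cnj (sip x y) = sip y x"
  by (simp add: sip_def mult.commute)

lemma sip_self: "sip x x = of_real (\<Sum>i\<in>UNIV. (norm (x $ i))\<^sup>2)"
  unfolding sip_def of_real_sum by (intro sum.cong) (auto simp: complex_norm_square [symmetric] mult.commute simp del: of_real_power)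

lemma sip_self_eq_0: "sip x x = 0 \<longleftrightarrow> x = 0"
  unfolding sip_self of_real_eq_0_iff by (subst sum_nonneg_eq_0_iff) (auto simp: vec_eq_iff)

lemma sip_axis: fixes x :: "complex^'a" shows "sip (axis i 1) x = x $ i"
proof -
  have "sip (axis i 1) x = (\<Sum>(j::'a)\<in>UNIV. (if j = i then x $ j else 0))"
    unfolding sip_def by (rule sum.cong) (auto simp: axis_def)
  then show ?thesis by simp
qed

lemma sip_ctranspose: "sip x (M *v y) = sip (ctranspose M *v x) y"
proof -
  have "sip x (M *v y) = (\<Sum>i\<in>UNIV. \<Sum>j\<in>UNIV. cnj (x $ i) * (M $ i $ j * y $ j))"
    by (simp add: sip_def matrix_vector_mult_def sum_distrib_left)
  also have "\<dots> = (\<Sum>j\<in>UNIV. \<Sum>i\<in>UNIV. cnj (x $ i) * (M $ i $ j * y $ j))"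
    by (rule sum.swap)
  also have "\<dots> = sip (ctranspose M *v x) y"
    by (simp add: sip_def matrix_vector_mult_def ctranspose_def sum_distrib_left mult_ac)
  finally show ?thesis .
qed

lemma ctranspose_ctranspose: "ctranspose (ctranspose M) = M"
  by (simp add: ctranspose_def vec_eq_iff)

lemma sip_ctranspose_right: "sip x (ctranspose M *v y) = sip (M *v x) y"
  using sip_ctranspose[of x "ctranspose M" y] by (simp add: ctranspose_ctranspose)

lemma herm_form_sip: "herm_form M x = Re (sip x (M *v x))"
  by (simp add: herm_form_def sip_def)

lemma vcnj_simps [simp]: "vcnj x $ i = cnj (x $ i)" "vcnj (vcnj x) = x" "vcnj x = 0 \<longleftrightarrow> x = 0"
  by (simp_all add: vcnj_def vec_eq_iff)

lemma cmat_vcnj: "cmat M *v vcnj x = vcnj (cmat M *v x)"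
  by (simp add: vec_eq_iff matrix_vector_mult_def)

lemma sip_vcnj: "sip (vcnj x) (vcnj y) = cnj (sip x y)"
  by (simp add: sip_def)

lemma cmat_mult: "cmat (M ** N) = cmat M ** cmat N"
  by (simp add: vec_eq_iff matrix_matrix_mult_def)

lemma cmat_transpose: "cmat (transpose M) = transpose (cmat M)"
  by (simp add: vec_eq_iff transpose_def)

lemma ctranspose_cmat: "ctranspose (cmat M) = cmat (transpose M)"
  by (simp add: vec_eq_iff transpose_def ctranspose_def)

lemma cmat_one: "cmat (mat 1) = mat 1"
  by (simp add: vec_eq_iff mat_def)

lemma cmat_zero: "cmat 0 = 0"
  by (simp add: vec_eq_iff)

lemma cmat_add: "cmat (M + N) = cmat M + cmat N"
  by (simp add: vec_eq_iff)

lemma matrix_vector_mult_scale: "(M :: 'a::comm_semiring_1^'n^'m) *v (c *s x) = c *s (M *v x)"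
  by (simp add: vec_eq_iff matrix_vector_mult_def sum_distrib_left mult_ac)

lemma cscale_mult: "cscale c M *v x = c *s (M *v x)"
  by (simp add: vec_eq_iff matrix_vector_mult_def sum_distrib_left mult_ac)

lemma mat_mult_vec: "mat (s :: 'a::comm_semiring_1) *v x = s *s x"
proof -
  have "(mat s *v x) $ i = s * x $ i" for i
  proof -
    have "(mat s *v x) $ i = (\<Sum>j\<in>UNIV. (if i = j then s else 0) * x $ j)"
      by (simp add: matrix_vector_mult_def mat_def)
    also have "\<dots> = (\<Sum>j\<in>UNIV. (if j = i then s * x $ j else 0))"
      by (rule sum.cong) auto
    finally show ?thesis by simp
  qed
  then show ?thesis by (simp add: vec_eq_iff)
qed

lemma cvec_Re_Im: "x = cvec (\<chi> i. Re (x $ i)) + \<i> *s cvec (\<chi> i. Im (x $ i))"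
  by (simp add: vec_eq_iff cvec_def complex_eq_iff)

lemma cvec_simps: "cvec (x + y) = cvec x + cvec y" "cvec (c *\<^sub>R x) = of_real c *s cvec x" "cvec 0 = 0"
  "cvec (M *v x) = cmat M *v cvec x"
  by (simp_all add: vec_eq_iff cvec_def matrix_vector_mult_def)

subsection \<open>The resolvent\<close>

text \<open>The spectrum, phrased as in the side condition of \<open>realization\<close>;
  \<open>eigs_iff\<close> links it to the eigenvectors in \<open>hurwitz\<close>.\<close>

definition eigs :: "real^'n^'n \<Rightarrow> complex set" where
  "eigs A = {s. \<not> invertible (mat s - cmat A)}"

definition resv :: "real^'n^'n \<Rightarrow> complex \<Rightarrow> complex^'n \<Rightarrow> complex^'n" where
  "resv A s x = matrix_inv (mat s - cmat A) *v x"

lemma invertible_iff_inj: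
  fixes M :: "'a::field^'n^'n"
  shows "invertible M \<longleftrightarrow> (\<forall>x. M *v x = 0 \<longrightarrow> x = 0)"
  by (simp add: invertible_left_inverse matrix_left_invertible_ker)

lemma eigs_iff: "s \<in> eigs A \<longleftrightarrow> (\<exists>v. v \<noteq> 0 \<and> cmat A *v v = s *s v)"
  by (simp add: eigs_def invertible_iff_inj matrix_vector_mult_diff_rdistrib mat_mult_vec) metis

lemma matrix_inv_mult_vec:
  fixes M :: "'a::field^'n^'n"
  assumes "invertible M"
  shows "M *v (matrix_inv M *v x) = x" "matrix_inv M *v (M *v x) = x"
proof -
  have "M ** matrix_inv M = mat 1 \<and> matrix_inv M ** M = mat 1"
    using assms unfolding invertible_def matrix_inv_def by (rule someI_ex)
  then show "M *v (matrix_inv M *v x) = x" "matrix_inv M *v (M *v x) = x"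
    by (simp_all only: matrix_vector_mul_assoc matrix_vector_mul_lid)
qed

lemma resv_eq:
  assumes "s \<notin> eigs A"
  shows "cmat A *v resv A s x = s *s resv A s x - x"
    and "resv A s (s *s x - cmat A *v x) = x"
    and "resv A s (cmat A *v x) = s *s resv A s x - x"
proof -
  have inv: "invertible (mat s - cmat A)" using assms by (simp add: eigs_def)
  show "cmat A *v resv A s x = s *s resv A s x - x"
    using matrix_inv_mult_vec(1)[OF inv, of x]
    by (simp add: resv_def matrix_vector_mult_diff_rdistrib mat_mult_vec algebra_simps)
  show *: "resv A s (s *s x - cmat A *v x) = x"
    using matrix_inv_mult_vec(2)[OF inv, of x]
    by (simp add: resv_def matrix_vector_mult_diff_rdistrib mat_mult_vec)
  show "resv A s (cmat A *v x) = s *s resv A s x - x"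
    using * by (simp add: resv_def matrix_vector_mult_diff_distrib matrix_vector_mult_scale algebra_simps)
qed

lemma resv_simps:
  "resv A s (x + y) = resv A s x + resv A s y" "resv A s (x - y) = resv A s x - resv A s y"
  "resv A s (c *s x) = c *s resv A s x" "resv A s 0 = 0"
  by (simp_all add: resv_def matrix_vector_right_distrib matrix_vector_mult_diff_distrib matrix_vector_mult_scale)

text \<open>The way in which state equations with input \<open>b\<close> are solved
  throughout.\<close>

lemma resv_unique:
  assumes "s \<notin> eigs A" "s *s x = cmat A *v x + b"
  shows "x = resv A s b"
proof -
  have "s *s x - cmat A *v x = b" using assms(2) by simp
  then show ?thesis using resv_eq(2)[OF assms(1), of x] by simp
qed

lemma eigs_cnj: "cnj s \<in> eigs A \<longleftrightarrow> s \<in> eigs A"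
proof -
  have "cnj s \<in> eigs A" if "s \<in> eigs A" for s
  proof -
    obtain v where v: "v \<noteq> 0" "cmat A *v v = s *s v" using \<open>s \<in> eigs A\<close> by (auto simp: eigs_iff)
    then have "cmat A *v vcnj v = cnj s *s vcnj v" by (simp add: cmat_vcnj vec_eq_iff)
    then show ?thesis using v(1) vcnj_simps(3) unfolding eigs_iff by blast
  qed
  from this[of s] this[of "cnj s"] show ?thesis by auto
qed

lemma resv_cnj:
  assumes "s \<notin> eigs A"
  shows "resv A (cnj s) (vcnj x) = vcnj (resv A s x)"
proof (rule resv_unique[symmetric])
  show "cnj s \<notin> eigs A" using assms by (simp add: eigs_cnj)
  show "cnj s *s vcnj (resv A s x) = cmat A *v vcnj (resv A s x) + vcnj x"
    using resv_eq(1)[OF assms, of x] by (simp add: cmat_vcnj vec_eq_iff)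
qed

lemma det_char_holomorphic: "(\<lambda>s. det (mat s - cmat A)) holomorphic_on X"
proof -
  have "(\<lambda>s. (mat s - cmat A) $ i $ j) holomorphic_on X" for i j
    by (cases "i = j") (auto simp: mat_def intro!: holomorphic_intros)
  then show ?thesis unfolding det_def by (intro holomorphic_intros) auto
qed

text \<open>Cramer's rule shows the entries as quotients of polynomials in \<open>s\<close>, from
  which holomorphy and meromorphy follow.\<close>

lemma resv_component:
  assumes "s \<notin> eigs A"
  shows "resv A s x $ k =
    det (\<chi> i j. if j = k then x $ i else (mat s - cmat A) $ i $ j) / det (mat s - cmat A)"
proof -
  have inv: "invertible (mat s - cmat A)" using assms by (simp add: eigs_def)
  then have "det (mat s - cmat A) \<noteq> 0" by (simp add: invertible_det_nz)
  from cramer[OF this, of "resv A s x" x] show ?thesis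
    using matrix_inv_mult_vec(1)[OF inv, of x] by (simp add: resv_def)
qed

lemma det_cramer_holomorphic:
  "(\<lambda>s. det (\<chi> i j. if j = k then x $ i else (mat s - cmat A) $ i $ j)) holomorphic_on X"
proof -
  have "(\<lambda>s. (\<chi> i j. if j = k then x $ i else (mat s - cmat A) $ i $ j) $ i $ j) holomorphic_on X" for i j
    by (cases "i = j"; cases "j = k") (auto simp: mat_def intro!: holomorphic_intros)
  then show ?thesis unfolding det_def by (intro holomorphic_intros) auto
qed

lemma resv_holomorphic: "(\<lambda>s. resv A s x $ k) holomorphic_on - eigs A"
proof (rule holomorphic_transform)
  show "(\<lambda>s. det (\<chi> i j. if j = k then x $ i else (mat s - cmat A) $ i $ j) / det (mat s - cmat A))
     holomorphic_on - eigs A"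
    by (intro holomorphic_intros det_cramer_holomorphic det_char_holomorphic)
       (simp add: eigs_def invertible_det_nz)
qed (simp add: resv_component)

lemma norm_matrix_vector_mult_bound:
  fixes M :: "complex^'n^'m"
  obtains K where "K > 0" "\<And>x. norm (M *v x) \<le> K * norm x"
proof -
  obtain K where "K > 0" "\<forall>x. norm (M *v x) \<le> norm x * K"
    using bounded_linear.pos_bounded[OF matrix_vector_mul_bounded_linear[of M]] by blast
  then show ?thesis using that[of K] by (simp add: mult.commute)
qed

lemma norm_vector_scale: "norm (c *s x) = norm c * norm (x :: complex^'n)"
  by (simp add: norm_vec_def L2_set_def norm_mult power_mult_distrib sum_distrib_left[symmetric]
      real_sqrt_mult)

text \<open>With \<open>K\<close> bounding the operator norm of \<open>A\<close>, take norms in s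
  R(s)x = x + A R(s)x and solve for the norm of R(s)x.\<close>

lemma resv_bound:
  obtains K where "K > 0" "\<And>s. norm s > K \<Longrightarrow> s \<notin> eigs A"
    "\<And>s x. norm s > K \<Longrightarrow> norm (resv A s x) \<le> norm x / (norm s - K)"
proof -
  obtain K where K: "K > 0" "\<And>x. norm (cmat A *v x) \<le> K * norm x"
    using norm_matrix_vector_mult_bound by blast
  have 1: "s \<notin> eigs A" if "norm s > K" for s
  proof
    assume "s \<in> eigs A"
    then obtain v where "v \<noteq> 0" "cmat A *v v = s *s v" by (auto simp: eigs_iff)
    then have "norm s * norm v \<le> K * norm v" using K(2)[of v] by (simp add: norm_vector_scale)
    then show False using \<open>v \<noteq> 0\<close> that by simp
  qed
  have 2: "norm (resv A s x) \<le> norm x / (norm s - K)" if "norm s > K" for s x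
  proof -
    have "s *s resv A s x = x + cmat A *v resv A s x" using resv_eq(1)[OF 1[OF that]] by simp
    then have "norm s * norm (resv A s x) = norm (x + cmat A *v resv A s x)"
      by (simp add: norm_vector_scale[symmetric])
    also have "\<dots> \<le> norm x + norm (cmat A *v resv A s x)" by (rule norm_triangle_ineq)
    also have "\<dots> \<le> norm x + K * norm (resv A s x)" using K(2) by simp
    finally have "norm s * norm (resv A s x) \<le> norm x + K * norm (resv A s x)" .
    then show ?thesis using that by (simp add: field_simps)
  qed
  show ?thesis using that[OF K(1) 1 2] by blast
qed

lemma eigs_eventually_at_infinity: "\<forall>\<^sub>F s in at_infinity. s \<notin> eigs A"
proof -
  obtain K where "K > 0" "\<And>s. norm s > K \<Longrightarrow> s \<notin> eigs A" using resv_bound by metis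
  then show ?thesis unfolding eventually_at_infinity by (intro exI[of _ "K + 1"]) auto
qed

text \<open>The characteristic polynomial is nonzero at a large real point, hence not identically
  zero, so its zeros are isolated.\<close>

lemma eigs_eventually_at: "\<forall>\<^sub>F s in at p. s \<notin> eigs A"
proof -
  obtain K where "K > 0" "\<And>s. norm s > K \<Longrightarrow> s \<notin> eigs A" using resv_bound by metis
  then have "of_real (K + 1) \<notin> eigs A" by (simp del: of_real_add)
  then have "det (mat (of_real (K + 1)) - cmat A) \<noteq> 0" by (simp add: eigs_def invertible_det_nz)
  from non_zero_neighbour_alt[OF det_char_holomorphic open_UNIV connected_UNIV, of p, OF _ _ this]
  show ?thesis by (simp add: eigs_def invertible_det_nz)
qed

lemma closed_eigs: "closed (eigs A)"
proof -
  have "continuous_on UNIV (\<lambda>s. det (mat s - cmat A))"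
    by (intro holomorphic_on_imp_continuous_on det_char_holomorphic)
  then have "closed {s. det (mat s - cmat A) = 0}" by (intro closed_Collect_eq) auto
  then show ?thesis by (simp add: eigs_def invertible_det_nz)
qed

lemma resv_tendsto_0_at_infinity: "((\<lambda>s. resv A s x) \<longlongrightarrow> 0) at_infinity"
proof -
  obtain K where K: "K > 0" "\<And>s x. norm s > K \<Longrightarrow> norm (resv A s x) \<le> norm x / (norm s - K)"
    using resv_bound by metis
  have "filterlim (\<lambda>s::complex. -K + norm s) at_top at_infinity"
    by (intro filterlim_tendsto_add_at_top[OF tendsto_const] filterlim_norm_at_top)
  then have lim: "((\<lambda>s::complex. norm x / (norm s - K)) \<longlongrightarrow> 0) at_infinity"
    by (intro tendsto_divide_0[OF tendsto_const] filterlim_at_top_imp_at_infinity) simp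
  have "\<forall>\<^sub>F s in at_infinity. norm (resv A s x) \<le> norm x / (norm s - K)"
    unfolding eventually_at_infinity using K by (intro exI[of _ "K + 1"]) auto
  then show ?thesis using lim by (rule Lim_null_comparison)
qed

lemma tendsto_matrix_vector_mult [tendsto_intros]:
  fixes M :: "complex^'n^'m"
  shows "(f \<longlongrightarrow> x) F \<Longrightarrow> ((\<lambda>s. M *v f s) \<longlongrightarrow> M *v x) F"
  by (rule bounded_linear.tendsto[OF matrix_vector_mul_bounded_linear])

lemma tendsto_matrix_apply:
  fixes f :: "'b \<Rightarrow> complex^'n^'m"
  assumes "(f \<longlongrightarrow> M) F"
  shows "((\<lambda>s. f s *v x) \<longlongrightarrow> M *v x) F"
  by (rule vec_tendstoI)
     (auto simp: matrix_vector_mult_def intro!: tendsto_sum tendsto_mult tendsto_vec_nth[OF tendsto_vec_nth[OF assms]])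

lemma tendsto_sip [tendsto_intros]:
  "(f \<longlongrightarrow> x) F \<Longrightarrow> (g \<longlongrightarrow> y) F \<Longrightarrow> ((\<lambda>s. sip (f s) (g s)) \<longlongrightarrow> sip x y) F"
  unfolding sip_def by (intro tendsto_intros)

text \<open>From s R(s)x = x + A R(s)x. It gives s G(s) a finite limit at infinity when G is
  strictly proper.\<close>

lemma scaled_resv_tendsto_at_infinity: "((\<lambda>s. s *s resv A s x) \<longlongrightarrow> x) at_infinity"
proof -
  have "((\<lambda>s. x + cmat A *v resv A s x) \<longlongrightarrow> x + cmat A *v 0) at_infinity"
    by (intro tendsto_intros resv_tendsto_0_at_infinity)
  then have lim: "((\<lambda>s. x + cmat A *v resv A s x) \<longlongrightarrow> x) at_infinity" by simp
  have "\<forall>\<^sub>F s in at_infinity. x + cmat A *v resv A s x = s *s resv A s x"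
    using eigs_eventually_at_infinity[of A] by eventually_elim (simp add: resv_eq)
  from tendsto_cong[OF this] show ?thesis using lim by blast
qed

lemma sip_resv_holomorphic: "(\<lambda>s. sip y (M *v resv A s x)) holomorphic_on - eigs A"
  unfolding sip_def matrix_vector_mult_def vec_lambda_beta
  by (intro holomorphic_intros resv_holomorphic)

lemma resv_tendsto: "p \<notin> eigs A \<Longrightarrow> ((\<lambda>s. resv A s x) \<longlongrightarrow> resv A p x) (at p)"
proof (rule vec_tendstoI)
  fix i assume "p \<notin> eigs A"
  then have "isCont (\<lambda>s. resv A s x $ i) p"
    using continuous_on_eq_continuous_at[OF open_Compl[OF closed_eigs]]
      holomorphic_on_imp_continuous_on[OF resv_holomorphic] by blast
  then show "((\<lambda>s. resv A s x $ i) \<longlongrightarrow> resv A p x $ i) (at p)" by (simp add: isCont_def)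
qed

subsection \<open>Minimal realizations\<close>

lemma realization_apply:
  assumes "realization G A B C D" "s \<notin> eigs A"
  shows "G s *v u = cmat C *v resv A s (cmat B *v u) + cmat D *v u"
  using assms
  by (simp add: realization_def eigs_def resv_def matrix_vector_mult_add_rdistrib matrix_vector_mul_assoc matrix_mul_assoc)

lemma sip_cvec_vector_matrix_mult: "sip (cvec (x v* M)) y = sip (cvec x) (cmat M *v y)"
proof -
  have "sip (cvec (x v* M)) y = (\<Sum>j\<in>UNIV. \<Sum>i\<in>UNIV. of_real (x $ i) * (of_real (M $ i $ j) * y $ j))"
    by (simp add: sip_def cvec_def vector_matrix_mult_def sum_distrib_right sum_distrib_left mult_ac)
  also have "\<dots> = (\<Sum>i\<in>UNIV. \<Sum>j\<in>UNIV. of_real (x $ i) * (of_real (M $ i $ j) * y $ j))"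
    by (rule sum.swap)
  finally show ?thesis
    by (simp add: sip_def cvec_def matrix_vector_mult_def sum_distrib_left)
qed

lemma sip_cvec_row: "sip (cvec (row p M)) y = (cmat M *v y) $ p"
  by (simp add: sip_def cvec_def row_def matrix_vector_mult_def)

lemma mult_axis_component: "(M *v axis q 1) $ p = (M :: 'a::semiring_1^'n^'m) $ p $ q"
  by (simp add: matrix_vector_mult_def axis_def if_distrib[of "\<lambda>x. _ * x"] cong: if_cong)

text \<open>The states of the smaller realization are the coordinates of \<open>(s I - A)\<^sup>-\<^sup>1 B\<close> along \<open>e\<close>;
  the functionals in \<open>L\<close> are those through which the state equation and the output see the state.\<close>

lemma has_realization_of_order_coordinates:
  fixes A :: "real^'n^'n" and e :: "nat \<Rightarrow> real^'n"
  assumes G: "realization G A B C D"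
    and coord: "\<forall>\<^sub>F s in at_infinity. \<forall>q l. l \<in> L \<longrightarrow>
        sip (cvec l) (resv A s (cmat B *v axis q 1)) =
        (\<Sum>j<k. of_real (l \<bullet> e j) * sip (cvec (e j)) (resv A s (cmat B *v axis q 1)))"
    and L: "\<And>i. i < k \<Longrightarrow> e i v* A \<in> L" "\<And>p. row p C \<in> L"
  shows "has_realization_of_order G k"
  unfolding has_realization_of_order_def
proof (rule exI[of _ "\<lambda>i j. (e i v* A) \<bullet> e j"], rule exI[of _ "\<lambda>i q. e i \<bullet> (B *v axis q 1)"],
    rule exI[of _ "\<lambda>p i. row p C \<bullet> e i"], rule exI[of _ D])
  let ?X = "\<lambda>s i q. sip (cvec (e i)) (resv A s (cmat B *v axis q 1))"
  show "\<forall>\<^sub>F s in at_infinity. \<exists>X.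
          (\<forall>i<k. \<forall>q. s * X i q - (\<Sum>j<k. of_real ((e i v* A) \<bullet> e j) * X j q) =
             of_real (e i \<bullet> (B *v axis q 1))) \<and>
          (\<forall>p q. G s $ p $ q = (\<Sum>i<k. of_real (row p C \<bullet> e i) * X i q) + of_real (D $ p $ q))"
    using coord eigs_eventually_at_infinity[of A]
  proof eventually_elim
    case (elim s)
    show ?case
    proof (intro exI[of _ "?X s"] conjI allI impI)
      fix i q assume i: "i < k"
      let ?x = "resv A s (cmat B *v axis q 1)"
      have B: "sip (cvec (e i)) (cmat B *v axis q 1) = of_real (e i \<bullet> (B *v axis q 1))"
      proof -
        have "cmat B *v axis q 1 = cvec (B *v axis q 1)"
          by (simp add: vec_eq_iff cvec_def mult_axis_component)
        then show ?thesis by (simp add: sip_def cvec_def inner_vec_def)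
      qed
      have eA: "sip (cvec (e i v* A)) ?x = s * sip (cvec (e i)) ?x - sip (cvec (e i)) (cmat B *v axis q 1)"
        using elim(2) by (simp add: sip_cvec_vector_matrix_mult resv_eq sip_simps)
      have "(\<Sum>j<k. of_real ((e i v* A) \<bullet> e j) * ?X s j q) = sip (cvec (e i v* A)) ?x"
        using elim(1) L(1)[OF i] by simp
      then show "s * ?X s i q - (\<Sum>j<k. of_real ((e i v* A) \<bullet> e j) * ?X s j q) =
             of_real (e i \<bullet> (B *v axis q 1))"
        by (simp add: eA B)
    next
      fix p q
      have "G s $ p $ q = (G s *v axis q 1) $ p" by (simp add: mult_axis_component)
      also have "\<dots> = sip (cvec (row p C)) (resv A s (cmat B *v axis q 1)) + of_real (D $ p $ q)"
        by (simp only: realization_apply[OF G elim(2)] sip_cvec_row vector_add_component)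
           (simp add: mult_axis_component)
      finally show "G s $ p $ q = (\<Sum>i<k. of_real (row p C \<bullet> e i) * ?X s i q) + of_real (D $ p $ q)"
        using elim(1) L(2) by simp
    qed
  qed
qed

text \<open>The basis is indexed by numbers below the dimension to match the state space in
  \<open>has_realization_of_order\<close>.\<close>

lemma orthonormal_enumeration:
  fixes S :: "(real^'n) set"
  assumes "subspace S"
  obtains e where "\<And>i. i < dim S \<Longrightarrow> e i \<in> S" "\<And>x. x \<in> S \<Longrightarrow> (\<Sum>i<dim S. (x \<bullet> e i) *\<^sub>R e i) = x"
proof -
  obtain E where E: "E \<subseteq> S" "pairwise orthogonal E" "\<And>x. x \<in> E \<Longrightarrow> norm x = 1"
      "independent E" "card E = dim S" "span E = S"
    using orthonormal_basis_subspace[OF assms] by blast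
  have fin: "finite E" using E(4) by (rule independent_imp_finite)
  obtain e where e: "bij_betw e {0..<card E} E" using ex_bij_betw_nat_finite[OF fin] by blast
  then have e': "bij_betw e {..<dim S} E" using E(5) by (simp add: atLeast0LessThan)
  show ?thesis
  proof (rule that[of e])
    show "e i \<in> S" if "i < dim S" for i using e' that E(1) by (auto simp: bij_betw_def)
    show "(\<Sum>i<dim S. (x \<bullet> e i) *\<^sub>R e i) = x" if "x \<in> S" for x
    proof -
      have "(\<Sum>i<dim S. (x \<bullet> e i) *\<^sub>R e i) = (\<Sum>b\<in>E. (x \<bullet> b) *\<^sub>R b)"
        by (rule sum.reindex_bij_betw[OF e'])
      also have "\<dots> = x" using orthonormal_basis_expand[OF E(2,3) _ fin] E(6) that by simp
      finally show ?thesis .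
    qed
  qed
qed

text \<open>Here the comparison of state dimensions in minimality becomes a statement about
  subspaces.\<close>

lemma minimal_imp_full_subspace:
  fixes A :: "real^'n^'n" and S :: "(real^'n) set"
  assumes "minimal_realization G A B C D" "subspace S" "has_realization_of_order G (dim S)"
  shows "S = UNIV"
proof -
  have "CARD('n) \<le> dim S" using assms by (simp add: minimal_realization_def)
  then have "dim S = DIM(real^'n)" using dim_subset_UNIV[of S] by simp
  then show ?thesis using assms(2) by (metis dim_eq_full span_eq_iff)
qed

lemma cvec_sum: "cvec (\<Sum>i\<in>I. f i) = (\<Sum>i\<in>I. cvec (f i))"
  by (simp add: cvec_def vec_eq_iff)

lemma sip_sum_left: "sip (\<Sum>i\<in>I. f i) y = (\<Sum>i\<in>I. sip (f i) y)"
  by (simp add: sip_def sum_distrib_right sum.swap[of _ I])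

lemma sip_sum_right: "sip x (\<Sum>i\<in>I. f i) = (\<Sum>i\<in>I. sip x (f i))"
  by (simp add: sip_def sum_distrib_left sum.swap[of _ I])

text \<open>Observability without the observability matrix: the state enters the output only through
  functionals in \<open>S\<close>, and these satisfy a closed state equation because
  \<open>S\<close> is invariant under the transpose of \<open>A\<close>.\<close>

lemma minimal_observable:
  fixes A :: "real^'n^'n"
  assumes min: "minimal_realization G A B C D" and S: "subspace S"
    and inv: "\<And>x. x \<in> S \<Longrightarrow> x v* A \<in> S" and rows: "\<And>p. row p C \<in> S"
  shows "S = UNIV"
proof (rule minimal_imp_full_subspace[OF min S])
  obtain e where e: "\<And>i. i < dim S \<Longrightarrow> e i \<in> S"
      "\<And>x. x \<in> S \<Longrightarrow> (\<Sum>i<dim S. (x \<bullet> e i) *\<^sub>R e i) = x"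
    using orthonormal_enumeration[OF S] by blast
  have *: "sip (cvec l) y = (\<Sum>j<dim S. of_real (l \<bullet> e j) * sip (cvec (e j)) y)" if "l \<in> S" for l y
  proof -
    have "sip (cvec l) y = sip (cvec (\<Sum>j<dim S. (l \<bullet> e j) *\<^sub>R e j)) y" using e(2)[OF that] by simp
    then show ?thesis by (simp add: cvec_sum sip_sum_left cvec_simps sip_simps)
  qed
  show "has_realization_of_order G (dim S)"
    by (rule has_realization_of_order_coordinates[where A = A and B = B and C = C and D = D and L = S and e = e])
       (use min * inv rows e(1) in \<open>auto simp: minimal_realization_def\<close>)
qed

text \<open>The orthogonal projection \<open>P\<close> onto \<open>S\<close> satisfies
  \<open>P ** (A ** P) = A ** P\<close> and \<open>P ** B = B\<close>, so every state reached from
  the input is fixed by \<open>P\<close> and determined by its coordinates in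
  \<open>S\<close>.\<close>

lemma minimal_controllable:
  fixes A :: "real^'n^'n"
  assumes min: "minimal_realization G A B C D" and S: "subspace S"
    and inv: "\<And>x. x \<in> S \<Longrightarrow> A *v x \<in> S" and cols: "\<And>u. B *v u \<in> S"
  shows "S = UNIV"
proof (rule minimal_imp_full_subspace[OF min S])
  obtain e where e: "\<And>i. i < dim S \<Longrightarrow> e i \<in> S"
      "\<And>x. x \<in> S \<Longrightarrow> (\<Sum>i<dim S. (x \<bullet> e i) *\<^sub>R e i) = x"
    using orthonormal_enumeration[OF S] by blast
  define P where "P = (\<chi> a b. \<Sum>i<dim S. e i $ a * e i $ b)"
  have P: "P *v x = (\<Sum>i<dim S. (x \<bullet> e i) *\<^sub>R e i)" for x
    by (simp add: P_def vec_eq_iff matrix_vector_mult_def inner_vec_def sum_distrib_right sum_distrib_left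
        sum.swap[of _ "{..<dim S}"] mult_ac)
  have PS: "P *v x \<in> S" for x unfolding P using e(1) S by (intro subspace_sum subspace_scale) auto
  have Pid: "P *v x = x" if "x \<in> S" for x using e(2)[OF that] P by simp
  have cP: "cmat P *v x = (\<Sum>i<dim S. sip (cvec (e i)) x *s cvec (e i))" for x
    by (simp add: P_def vec_eq_iff matrix_vector_mult_def sip_def cvec_def sum_distrib_right sum_distrib_left
        sum.swap[of _ "{..<dim S}"] mult_ac)
  have PAP: "P ** (A ** P) = A ** P"
    using Pid[OF inv[OF PS]] by (simp add: matrix_eq matrix_vector_mul_assoc[symmetric])
  have PB: "P ** B = B"
    using Pid[OF cols] by (simp add: matrix_eq matrix_vector_mul_assoc[symmetric])
  have cPAP: "cmat P *v (cmat A *v (cmat P *v y)) = cmat A *v (cmat P *v y)" for y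
    using arg_cong[OF PAP, of "\<lambda>M. cmat M *v y"] by (simp add: cmat_mult matrix_vector_mul_assoc[symmetric])
  have cPB: "cmat P *v (cmat B *v y) = cmat B *v y" for y
    using arg_cong[OF PB, of "\<lambda>M. cmat M *v y"] by (simp add: cmat_mult matrix_vector_mul_assoc[symmetric])
  \<comment> \<open>The state of \<open>A ** P\<close> is fixed by \<open>P\<close>, after
    cancelling \<open>s\<close>; therefore it also solves the state equation of
    \<open>A\<close>.\<close>
  have fixed: "cmat P *v resv A s (cmat B *v u) = resv A s (cmat B *v u)"
    if s: "s \<notin> eigs A" "s \<notin> eigs (A ** P)" "s \<noteq> 0" for s u
  proof -
    let ?x = "resv (A ** P) s (cmat B *v u)"
    have eq: "s *s ?x = cmat A *v (cmat P *v ?x) + cmat B *v u"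
      using resv_eq(1)[OF s(2), of "cmat B *v u"] by (simp add: cmat_mult matrix_vector_mul_assoc[symmetric])
    then have "s *s (cmat P *v ?x) = cmat P *v (cmat A *v (cmat P *v ?x)) + cmat P *v (cmat B *v u)"
      by (simp add: matrix_vector_mult_scale[symmetric] matrix_vector_right_distrib)
    also have "\<dots> = s *s ?x"
      by (simp only: eq cPAP cPB)
    finally have "cmat P *v ?x = ?x" using s(3) by (simp add: vec_eq_iff)
    moreover from this eq have "?x = resv A s (cmat B *v u)" by (intro resv_unique[OF s(1)]) simp
    ultimately show ?thesis by simp
  qed
  have coord: "\<forall>\<^sub>F s in at_infinity. \<forall>q l. l \<in> UNIV \<longrightarrow>
        sip (cvec l) (resv A s (cmat B *v axis q 1)) =
        (\<Sum>j<dim S. of_real (l \<bullet> e j) * sip (cvec (e j)) (resv A s (cmat B *v axis q 1)))"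
    using eigs_eventually_at_infinity[of A] eigs_eventually_at_infinity[of "A ** P"]
      eventually_not_equal_at_infinity[of 0]
  proof eventually_elim
    case (elim s)
    have "sip (cvec l) (resv A s (cmat B *v axis q 1)) =
        (\<Sum>j<dim S. of_real (l \<bullet> e j) * sip (cvec (e j)) (resv A s (cmat B *v axis q 1)))" for q l
    proof -
      have "sip (cvec l) (cvec (e j)) = of_real (l \<bullet> e j)" for j
        by (simp add: sip_def cvec_def inner_vec_def)
      then show ?thesis
        by (subst fixed[OF elim, symmetric]) (simp add: cP sip_sum_right sip_simps mult.commute)
    qed
    then show ?case by (intro allI impI)
  qed
  show "has_realization_of_order G (dim S)"
    by (rule has_realization_of_order_coordinates[where A = A and B = B and C = C and D = D and L = UNIV and e = e, OF _ coord])
       (use min in \<open>auto simp: minimal_realization_def\<close>)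
qed

text \<open>The Popov-Belevitch-Hautus test: the real functionals vanishing at \<open>v\<close> form
  an invariant subspace containing the rows of \<open>C\<close>.\<close>

lemma minimal_unobservable_eigenvector:
  fixes A :: "real^'n^'n"
  assumes min: "minimal_realization G A B C D"
    and v: "cmat A *v v = l *s v" "cmat C *v v = 0"
  shows "v = 0"
proof -
  have "{p. sip (cvec p) v = 0} = UNIV"
  proof (rule minimal_observable[OF min])
    show "subspace {p. sip (cvec p) v = 0}"
      by (auto simp: subspace_def cvec_simps sip_simps)
  qed (auto simp: sip_cvec_vector_matrix_mult sip_cvec_row v sip_simps)
  then have "sip (cvec (axis i 1)) v = 0" for i by blast
  moreover have "cvec (axis i 1) = axis i 1" for i :: 'n by (simp add: vec_eq_iff cvec_def axis_def)
  ultimately show ?thesis by (simp add: sip_axis vec_eq_iff)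
qed

text \<open>Controllability propagates a pole bound from \<open>(s I - A)\<^sup>-\<^sup>1 B\<close> to \<open>(s I - A)\<^sup>-\<^sup>1\<close>, because
  \<open>(s I - A)\<^sup>-\<^sup>1 A = s (s I - A)\<^sup>-\<^sup>1 - I\<close>.\<close>

lemma minimal_resolvent_order:
  fixes A :: "real^'n^'n"
  assumes min: "minimal_realization G A B C D" and d: "d > 0"
    and lim: "\<And>u. ((\<lambda>s. (s - p) ^ d * sip w (resv A s (cmat B *v u))) \<longlongrightarrow> 0) (at p)"
  shows "((\<lambda>s. (s - p) ^ d * sip w (resv A s x)) \<longlongrightarrow> 0) (at p)"
proof -
  define N where "N = (\<lambda>x. ((\<lambda>s. (s - p) ^ d * sip w (resv A s x)) \<longlongrightarrow> 0) (at p))"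
  have add: "N (x + y)" if "N x" "N y" for x y
    using tendsto_add[OF that[unfolded N_def]] by (simp add: N_def resv_simps sip_simps algebra_simps)
  have scale: "N (c *s x)" if "N x" for c x
    using tendsto_mult_left[OF that[unfolded N_def], of c] by (simp add: N_def resv_simps sip_simps mult_ac)
  have zero: "N 0" by (simp add: N_def resv_simps sip_simps)
  have mult: "N (cmat A *v x)" if "N x" for x
  proof -
    \<comment> \<open>The second term comes from the identity in R(s)A = s R(s) - I and tends to 0
      because \<open>d > 0\<close>.\<close>
    have "((\<lambda>s. s * ((s - p) ^ d * sip w (resv A s x)) - (s - p) ^ d * sip w x) \<longlongrightarrow> p * 0 - (p - p) ^ d * sip w x) (at p)"
      using that unfolding N_def by (intro tendsto_intros)
    then have "((\<lambda>s. s * ((s - p) ^ d * sip w (resv A s x)) - (s - p) ^ d * sip w x) \<longlongrightarrow> 0) (at p)"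
      using d by (simp add: power_0_left)
    moreover have "\<forall>\<^sub>F s in at p. s * ((s - p) ^ d * sip w (resv A s x)) - (s - p) ^ d * sip w x =
        (s - p) ^ d * sip w (resv A s (cmat A *v x))"
      using eigs_eventually_at[of A p] by eventually_elim (simp add: resv_eq(3) sip_simps algebra_simps)
    ultimately show ?thesis unfolding N_def by (rule Lim_transform_eventually)
  qed
  have "{x. N (cvec x)} = UNIV"
  proof (rule minimal_controllable[OF min])
    show "subspace {x. N (cvec x)}"
      using add scale zero by (auto simp: subspace_def cvec_simps)
    show "A *v x \<in> {x. N (cvec x)}" if "x \<in> {x. N (cvec x)}" for x
      using that mult by (simp add: cvec_simps)
    show "B *v u \<in> {x. N (cvec x)}" for u
      using lim[of "cvec u"] by (simp add: N_def cvec_simps)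
  qed
  \<comment> \<open>Controllability speaks of real vectors; a complex \<open>x\<close> is reached
    through its real and imaginary parts.\<close>
  then have real: "N (cvec x)" for x by blast
  have "N x" by (subst cvec_Re_Im) (intro add scale real)
  then show ?thesis by (simp add: N_def)
qed

section \<open>Poles of the transfer function and eigenvalues of the state matrix\<close>

lemma resv_meromorphic: "(\<lambda>s. sip y (M *v resv A s x)) meromorphic_on {z}"
proof -
  have "(\<lambda>s. resv A s x $ k) meromorphic_on {z}" for k
  proof -
    let ?f = "\<lambda>s. det (\<chi> i j. if j = k then x $ i else (mat s - cmat A) $ i $ j) / det (mat s - cmat A)"
    have "\<forall>\<^sub>F s in at z. ?f s = resv A s x $ k"
      using eigs_eventually_at[of A z] by eventually_elim (simp add: resv_component)
    moreover have "?f meromorphic_on {z}"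
    proof (rule meromorphic_on_divide)
      have an: "g meromorphic_on {z}" if "g holomorphic_on UNIV" for g
        by (rule analytic_on_imp_meromorphic_on, rule analytic_on_subset[OF _ subset_UNIV])
           (simp add: analytic_on_open that)
      show "(\<lambda>s. det (\<chi> i j. if j = k then x $ i else (mat s - cmat A) $ i $ j)) meromorphic_on {z}"
        by (rule an) (rule det_cramer_holomorphic)
      show "(\<lambda>s. det (mat s - cmat A)) meromorphic_on {z}"
        by (rule an) (rule det_char_holomorphic)
    qed
    ultimately show ?thesis using meromorphic_on_cong[of "{z}" ?f "\<lambda>s. resv A s x $ k" "{z}"] by simp
  qed
  then show ?thesis
    unfolding sip_def matrix_vector_mult_def vec_lambda_beta by (intro meromorphic_intros)
qed

lemma realization_component_meromorphic:
  assumes "realization G A B C D"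
  shows "(\<lambda>s. G s $ p $ q) meromorphic_on {z}"
proof -
  let ?f = "\<lambda>s. sip (axis p 1) (cmat C *v resv A s (cmat B *v axis q 1)) + of_real (D $ p $ q)"
  have "\<forall>\<^sub>F s in at z. ?f s = G s $ p $ q"
    using eigs_eventually_at[of A z]
  proof eventually_elim
    case (elim s)
    have "G s $ p $ q = (G s *v axis q 1) $ p" by (simp add: mult_axis_component)
    also have "\<dots> = (cmat C *v resv A s (cmat B *v axis q 1)) $ p + of_real (D $ p $ q)"
      by (simp only: realization_apply[OF assms elim] vector_add_component) (simp add: mult_axis_component)
    finally show ?case by (simp add: sip_axis)
  qed
  moreover have "?f meromorphic_on {z}" by (intro meromorphic_intros resv_meromorphic)
  ultimately show ?thesis using meromorphic_on_cong[of "{z}" ?f "\<lambda>s. G s $ p $ q" "{z}"] by simp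
qed

text \<open>The entries are meromorphic, so a point that is not a pole is a removable singularity,
  whatever value \<open>G\<close> takes there.\<close>

lemma no_pole_iff_limit:
  assumes G: "realization G A B C D"
  shows "\<not> has_pole G z \<longleftrightarrow> (\<exists>K. (G \<longlongrightarrow> K) (at z))"
proof
  assume "\<not> has_pole G z"
  then have "\<exists>c. ((\<lambda>s. G s $ p $ q) \<longlongrightarrow> c) (at z)" for p q
    using realization_component_meromorphic[OF G, of p q z]
    by (auto simp: meromorphic_at_iff not_essential_def has_pole_def)
  then obtain c where c: "\<And>p q. ((\<lambda>s. G s $ p $ q) \<longlongrightarrow> c p q) (at z)" by metis
  have "(G \<longlongrightarrow> (\<chi> p q. c p q)) (at z)" by (intro vec_tendstoI) (simp add: c)
  then show "\<exists>K. (G \<longlongrightarrow> K) (at z)" by blast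
next
  assume "\<exists>K. (G \<longlongrightarrow> K) (at z)"
  then obtain K where K: "(G \<longlongrightarrow> K) (at z)" by blast
  have "\<not> is_pole (\<lambda>s. G s $ p $ q) z" for p q
    unfolding is_pole_def
    using not_tendsto_and_filterlim_at_infinity[OF _ tendsto_vec_nth[OF tendsto_vec_nth[OF K]]] by force
  then show "\<not> has_pole G z" by (simp add: has_pole_def)
qed

text \<open>For an eigenvector \<open>v\<close> at \<open>z\<close> one has (s - z)R(s)v = v. If
  \<open>G\<close> has a limit at \<open>z\<close>, then \<open>minimal_resolvent_order\<close> with
  \<open>d = 1\<close> forces Cv = 0, against observability.\<close>

lemma minimal_eigenvalue_is_pole:
  assumes min: "minimal_realization G A B C D" and np: "\<not> has_pole G z"
  shows "z \<notin> eigs A"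
proof
  assume "z \<in> eigs A"
  then obtain v where v: "v \<noteq> 0" "cmat A *v v = z *s v" by (auto simp: eigs_iff)
  have G: "realization G A B C D" using min by (simp add: minimal_realization_def)
  obtain K where K: "(G \<longlongrightarrow> K) (at z)" using np no_pole_iff_limit[OF G] by blast
  have "(cmat C *v v) $ p = 0" for p
  proof -
    define w where "w = cvec (row p C)"
    have w: "sip w x = (cmat C *v x) $ p" for x by (simp add: w_def sip_cvec_row)
    have "((\<lambda>s. (s - z) ^ 1 * sip w (resv A s v)) \<longlongrightarrow> 0) (at z)"
    proof (rule minimal_resolvent_order[OF min])
      fix u
      have "((\<lambda>s. (s - z) * sip (axis p 1) (G s *v u - cmat D *v u)) \<longlongrightarrow> (z - z) * sip (axis p 1) (K *v u - cmat D *v u)) (at z)"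
        by (intro tendsto_intros tendsto_matrix_apply K)
      then have "((\<lambda>s. (s - z) * sip (axis p 1) (G s *v u - cmat D *v u)) \<longlongrightarrow> 0) (at z)" by simp
      moreover have "\<forall>\<^sub>F s in at z. (s - z) * sip (axis p 1) (G s *v u - cmat D *v u) = (s - z) ^ 1 * sip w (resv A s (cmat B *v u))"
        using eigs_eventually_at[of A z] by eventually_elim (simp add: realization_apply[OF G] w sip_axis)
      ultimately show "((\<lambda>s. (s - z) ^ 1 * sip w (resv A s (cmat B *v u))) \<longlongrightarrow> 0) (at z)"
        by (rule Lim_transform_eventually)
    qed simp
    moreover have "\<forall>\<^sub>F s in at z. (s - z) ^ 1 * sip w (resv A s v) = sip w v"
      using eigs_eventually_at[of A z] eventually_neq_at_within[of z z UNIV]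
    proof eventually_elim
      case (elim s)
      have "s *s v - cmat A *v v = (s - z) *s v" using v(2) by (simp add: vec_eq_iff algebra_simps)
      then have "(s - z) *s resv A s v = v" using resv_eq(2)[OF elim(1), of v] by (simp add: resv_simps)
      then show ?case by (metis power_one_right sip_simps(5))
    qed
    ultimately have "((\<lambda>s. sip w v) \<longlongrightarrow> 0) (at z)" by (rule Lim_transform_eventually)
    then show ?thesis by (simp add: w tendsto_const_iff)
  qed
  then have "cmat C *v v = 0" by (simp add: vec_eq_iff)
  from minimal_unobservable_eigenvector[OF min v(2) this] v(1) show False by simp
qed

text \<open>Because the matrices are real; this carries conditions at positive frequencies over to
  negative ones.\<close>

lemma realization_cnj:
  assumes "realization G A B C D" "s \<notin> eigs A"
  shows "G (cnj s) *v vcnj u = vcnj (G s *v u)"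
  using assms
  by (simp add: realization_apply eigs_cnj cmat_vcnj resv_cnj) (simp add: vec_eq_iff)

lemma sip_realization_cnj:
  assumes "realization G A B C D" "s \<notin> eigs A"
  shows "sip (vcnj u) (G (cnj s) *v vcnj u) = cnj (sip u (G s *v u))"
  by (simp add: realization_cnj[OF assms] sip_vcnj)

lemma realization_tendsto:
  assumes G: "realization G A B C D" and p: "p \<notin> eigs A"
  shows "(G \<longlongrightarrow> G p) (at p)"
proof -
  have "((\<lambda>s. G s *v u) \<longlongrightarrow> G p *v u) (at p)" for u
  proof (rule Lim_transform_eventually)
    show "\<forall>\<^sub>F s in at p. cmat C *v resv A s (cmat B *v u) + cmat D *v u = G s *v u"
      using eigs_eventually_at[of A p] by eventually_elim (simp add: realization_apply[OF G])
    show "((\<lambda>s. cmat C *v resv A s (cmat B *v u) + cmat D *v u) \<longlongrightarrow> G p *v u) (at p)"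
      unfolding realization_apply[OF G p] by (intro tendsto_intros resv_tendsto p)
  qed
  then have "((\<lambda>s. (G s *v axis j 1) $ i) \<longlongrightarrow> (G p *v axis j 1) $ i) (at p)" for i j
    by (intro tendsto_vec_nth)
  then show ?thesis by (intro vec_tendstoI) (simp add: mult_axis_component)
qed

lemma realization_holomorphic:
  assumes G: "realization G A B C D"
  shows "(\<lambda>s. sip w (G s *v u)) holomorphic_on - eigs A"
proof (rule holomorphic_transform)
  show "(\<lambda>s. sip w (cmat C *v resv A s (cmat B *v u)) + sip w (cmat D *v u)) holomorphic_on - eigs A"
    by (intro holomorphic_intros sip_resv_holomorphic)
qed (simp add: realization_apply[OF G] sip_simps)

lemma realization_component_sip: "G s $ p $ q = sip (axis p 1) (G s *v axis q 1)"
  by (simp add: sip_axis mult_axis_component)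

lemma tendsto_cscale:
  fixes g :: "'b \<Rightarrow> complex^'n^'m"
  shows "(f \<longlongrightarrow> c) F \<Longrightarrow> (g \<longlongrightarrow> M) F \<Longrightarrow> ((\<lambda>s. cscale (f s) (g s)) \<longlongrightarrow> cscale c M) F"
  by (intro vec_tendstoI) (auto intro!: tendsto_mult tendsto_vec_nth)

section \<open>Hermitian forms, semidefiniteness and limits at 0\<close>

lemma hermitian_sip:
  assumes "hermitian M"
  shows "sip x (M *v y) = cnj (sip y (M *v x))"
  using assms by (metis cnj_sip hermitian_def sip_ctranspose)

lemma pos_semidef_sip:
  assumes "pos_semidef M"
  obtains k :: real where "k \<ge> 0" "sip x (M *v x) = of_real k"
proof
  have "sip x (M *v x) = cnj (sip x (M *v x))"
    using assms hermitian_sip by (auto simp: pos_semidef_def)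
  then have "Im (sip x (M *v x)) = 0" by (metis cnj.sel(2) equal_neg_zero)
  then show "sip x (M *v x) = of_real (herm_form M x)" by (simp add: herm_form_sip complex_eq_iff)
  show "herm_form M x \<ge> 0" using assms by (simp add: pos_semidef_def)
qed

lemma pos_semidef_zero: "pos_semidef 0"
  by (simp add: pos_semidef_def hermitian_def ctranspose_def herm_form_def vec_eq_iff)

lemma pos_semidef_cscale:
  assumes "pos_semidef M" "c \<ge> 0"
  shows "pos_semidef (cscale (of_real c) M)"
proof -
  have "herm_form (cscale (of_real c) M) x = c * herm_form M x" for x
    by (simp add: herm_form_sip cscale_mult sip_simps)
  then show ?thesis
    using assms by (auto simp: pos_semidef_def hermitian_def ctranspose_def vec_eq_iff)
qed

lemma pos_semidef_cnj:
  assumes "pos_semidef M"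
  shows "pos_semidef (map_matrix cnj M)"
proof -
  have "map_matrix cnj M *v x = vcnj (M *v vcnj x)" for x
    by (simp add: vec_eq_iff matrix_vector_mult_def)
  then have "sip x (map_matrix cnj M *v x) = cnj (sip (vcnj x) (M *v vcnj x))" for x
    by (metis sip_vcnj vcnj_simps(2))
  then show ?thesis
    using assms by (simp add: pos_semidef_def herm_form_sip hermitian_def ctranspose_def vec_eq_iff)
qed

lemma sip_eq_0_all:
  assumes "\<And>x. sip x y = 0"
  shows "y = 0"
  using assms[of y] sip_self_eq_0 by blast

text \<open>Polarization: \<open>x + y\<close> relates the imaginary parts, and
  \<open>\<i> *s y\<close> then the real parts.\<close>

lemma hermitian_real_form:
  assumes "\<And>x. Im (sip x (M *v x)) = 0"
  shows "hermitian M"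
proof -
  have 1: "Im (sip x (M *v y)) = - Im (sip y (M *v x))" for x y
    using assms[of "x + y"] assms[of x] assms[of y] by (simp add: sip_simps matrix_vector_right_distrib)
  have 2: "Re (sip x (M *v y)) = Re (sip y (M *v x))" for x y
    using 1[of x "\<i> *s y"] by (simp add: sip_simps matrix_vector_mult_scale)
  have "sip x (M *v y) = cnj (sip y (M *v x))" for x y
    using 1[of x y] 2[of x y] by (simp add: complex_eq_iff)
  then have "cnj (M $ j $ i) = M $ i $ j" for i j
    by (metis sip_axis mult_axis_component)
  then show ?thesis by (simp add: hermitian_def ctranspose_def vec_eq_iff)
qed

text \<open>Turns the matrix inequality at s = jw into a sign of the imaginary part of the form,
  that is, of the real part of s times the form.\<close>

lemma herm_form_imaginary_part:
  "herm_form (cscale \<i> (M - ctranspose M)) x = - 2 * Im (sip x (M *v x))"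
  using cnj_sip[of "M *v x" x]
  by (simp add: herm_form_sip cscale_mult sip_simps matrix_vector_mult_diff_rdistrib sip_ctranspose_right
      flip: cnj_sip[of x "M *v x"])

lemma filterlim_imaginary_at_right: "filterlim (\<lambda>t::real. \<i> * of_real t) (at 0) (at_right 0)"
proof (rule filterlim_atI)
  have "((\<lambda>t::real. \<i> * of_real t) \<longlongrightarrow> \<i> * of_real 0) (at_right 0)" by (intro tendsto_intros)
  then show "((\<lambda>t::real. \<i> * of_real t) \<longlongrightarrow> 0) (at_right 0)" by simp
  show "\<forall>\<^sub>F t in at_right (0::real). \<i> * of_real t \<noteq> 0" by (auto simp: eventually_at_filter)
qed

lemma filterlim_cnj_at: "filterlim cnj (at (cnj p)) (at p)"
proof (rule filterlim_atI)
  show "(cnj \<longlongrightarrow> cnj p) (at p)" by (intro tendsto_intros)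
  show "\<forall>\<^sub>F x in at p. cnj x \<noteq> cnj p" by (auto simp: eventually_at_filter)
qed

text \<open>Applying the sign condition to \<open>x\<close> and to its conjugate forces equality, since \<open>F\<close> is real.\<close>

lemma hermitian_limit_at_0:
  assumes lim: "(F \<longlongrightarrow> M) (at 0)"
    and real: "\<forall>\<^sub>F s in at 0. \<forall>x. F (cnj s) *v vcnj x = vcnj (F s *v x)"
    and sign: "\<forall>\<^sub>F t in at_right (0::real). \<forall>x. Im (sip x (F (\<i> * of_real t) *v x)) \<le> 0"
  shows "hermitian M"
proof (rule hermitian_real_form)
  have le: "Im (sip x (M *v x)) \<le> 0" for x
  proof (rule tendsto_upperbound[OF _ _ trivial_limit_at_right_real])
    show "((\<lambda>t. Im (sip x (F (\<i> * of_real t) *v x))) \<longlongrightarrow> Im (sip x (M *v x))) (at_right 0)"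
      by (intro tendsto_intros tendsto_matrix_apply filterlim_compose[OF lim filterlim_imaginary_at_right])
    show "\<forall>\<^sub>F t in at_right (0::real). Im (sip x (F (\<i> * of_real t) *v x)) \<le> 0"
      using sign by eventually_elim auto
  qed
  have "M *v vcnj x = vcnj (M *v x)" for x
  proof (rule tendsto_unique)
    have "filterlim cnj (at 0) (at 0)" using filterlim_cnj_at[of 0] by simp
    then show "((\<lambda>s. F (cnj s) *v vcnj x) \<longlongrightarrow> M *v vcnj x) (at 0)"
      by (intro tendsto_matrix_apply filterlim_compose[OF lim])
    have "((\<lambda>s. vcnj (F s *v x)) \<longlongrightarrow> vcnj (M *v x)) (at 0)"
      unfolding vcnj_def
      by (intro vec_tendstoI) (auto intro!: tendsto_cnj tendsto_vec_nth tendsto_matrix_apply lim)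
    then show "((\<lambda>s. F (cnj s) *v vcnj x) \<longlongrightarrow> vcnj (M *v x)) (at 0)"
      by (rule Lim_transform_eventually) (use real in eventually_elim, auto)
  qed simp
  then have "sip (vcnj x) (M *v vcnj x) = cnj (sip x (M *v x))" for x by (simp add: sip_vcnj)
  then show "Im (sip x (M *v x)) = 0" for x using le[of x] le[of "vcnj x"] by simp
qed

text \<open>The variational step used to show that an isotropic vector of a semidefinite form lies
  in its kernel.\<close>

lemma linear_term_eq_0:
  fixes a b :: real
  assumes "\<And>t. 0 \<le> b * t + a * t\<^sup>2"
  shows "b = 0"
proof (rule ccontr)
  assume b: "b \<noteq> 0"
  obtain K where K: "K > 0" "a < K" by (rule that[of "\<bar>a\<bar> + 1"]) auto
  have "0 \<le> b * (- b / K) + a * (- b / K)\<^sup>2" by (rule assms)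
  also have "\<dots> = (b\<^sup>2 / K\<^sup>2) * (a - K)"
    using K by (simp add: field_simps power2_eq_square)
  also have "\<dots> < 0" using b K by (intro mult_pos_neg) auto
  finally show False by simp
qed

subsection \<open>Strictly negative imaginary systems\<close>

locale sni_system =
  fixes H :: "complex \<Rightarrow> complex^'m^'m" and A :: "real^'k^'k" and B :: "real^'m^'k"
    and C :: "real^'k^'m" and D :: "real^'m^'m"
  assumes minimal: "minimal_realization H A B C D" and sni: "strictly_negative_imaginary H"
begin

lemma real: "realization H A B C D"
  using minimal by (simp add: minimal_realization_def)

lemma no_eigs: "Re s \<ge> 0 \<Longrightarrow> s \<notin> eigs A"
  using minimal_eigenvalue_is_pole[OF minimal] sni by (auto simp: strictly_negative_imaginary_def)

lemma axis_pos_upper: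
  assumes "w > 0" "y \<noteq> 0"
  shows "Re ((\<i> * of_real w) * sip y (H (\<i> * of_real w) *v y)) > 0"
proof -
  have "herm_form (cscale \<i> (H (\<i> * of_real w) - ctranspose (H (\<i> * of_real w)))) y > 0"
    using sni assms by (simp add: strictly_negative_imaginary_def pos_def_def)
  then have "Im (sip y (H (\<i> * of_real w) *v y)) < 0" by (simp only: herm_form_imaginary_part)
  then have "w * Im (sip y (H (\<i> * of_real w) *v y)) < 0" using assms(1) by (intro mult_pos_neg)
  then show ?thesis by (simp add: algebra_simps)
qed

lemma axis_pos:
  assumes s: "Re s = 0" "s \<noteq> 0" and y: "y \<noteq> 0"
  shows "Re (s * sip y (H s *v y)) > 0"
proof (cases "Im s > 0")
  case True
  have "s = \<i> * of_real (Im s)" using s by (simp add: complex_eq_iff)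
  then show ?thesis using axis_pos_upper[OF True y] by simp
next
  case False
  \<comment> \<open>Negative frequencies: reflect to the upper half of the axis and conjugate the
    vector.\<close>
  define t where "t = \<i> * of_real (- Im s)"
  have t: "cnj t = s" using s by (simp add: t_def complex_eq_iff)
  have "Im s \<noteq> 0" using s by (auto simp: complex_eq_iff)
  then have "Re (t * sip (vcnj y) (H t *v vcnj y)) > 0"
    unfolding t_def using False y by (intro axis_pos_upper) auto
  moreover have "sip (vcnj (vcnj y)) (H (cnj t) *v vcnj (vcnj y)) = cnj (sip (vcnj y) (H t *v vcnj y))"
    by (rule sip_realization_cnj[OF real no_eigs]) (simp add: t_def)
  then have "s * sip y (H s *v y) = cnj (t * sip (vcnj y) (H t *v vcnj y))" by (simp add: t)
  ultimately show ?thesis by simp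
qed

lemma axis_nonneg: "Re s = 0 \<Longrightarrow> s \<noteq> 0 \<Longrightarrow> Re (s * sip y (H s *v y)) \<ge> 0"
  using axis_pos[of s y] by (cases "y = 0") (auto simp: sip_simps)

text \<open>The SNI inequality concerns only \<open>w > 0\<close>; at 0 its limit combines with the
  reality of \<open>H\<close>.\<close>

lemma hermitian_dc: "hermitian (H 0)"
proof (rule hermitian_limit_at_0)
  show "(H \<longlongrightarrow> H 0) (at 0)" by (rule realization_tendsto[OF real no_eigs]) simp
  show "\<forall>\<^sub>F s in at 0. \<forall>x. H (cnj s) *v vcnj x = vcnj (H s *v x)"
    using eigs_eventually_at[of A 0] by eventually_elim (auto simp: realization_cnj[OF real])
  have "\<forall>\<^sub>F t in at_right (0::real). t > 0" by (simp add: eventually_at_filter)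
  then show "\<forall>\<^sub>F t in at_right (0::real). \<forall>x. Im (sip x (H (\<i> * of_real t) *v x)) \<le> 0"
  proof eventually_elim
    case (elim t)
    have "0 \<le> Re ((\<i> * of_real t) * sip x (H (\<i> * of_real t) *v x))" for x
      using elim by (intro axis_nonneg) auto
    then show ?case using elim by (auto simp: mult_le_0_iff)
  qed
qed

text \<open>As \<open>h 0\<close> is real, on the axis the real part of the quotient is that of
  \<open>s * h s\<close> divided by the square of \<open>norm s\<close>. Subtracting
  \<open>h 0\<close> removes the pole at 0, and properness of \<open>H\<close> makes the quotient
  vanish at infinity.\<close>

lemma positive_real_quotient:
  assumes z: "Re z > 0"
  shows "Re ((sip y (H 0 *v y) - sip y (H z *v y)) / z) \<ge> 0"
proof -
  define h where "h = (\<lambda>s. sip y (H s *v y))"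
  have h0: "Im (h 0) = 0"
    using hermitian_sip[OF hermitian_dc, of y y] by (metis h_def cnj.sel(2) equal_neg_zero)
  have hlim: "(h \<longlongrightarrow> h p) (at p)" if "Re p = 0" for p
    unfolding h_def using that by (intro tendsto_intros tendsto_matrix_apply realization_tendsto[OF real no_eigs]) simp
  \<comment> \<open>At 0 the quotient has the default value of division by zero, not its limit, so 0
    counts as a singularity.\<close>
  let ?S = "insert 0 (eigs A)"
  have "Re ((h 0 - h z) / z) \<ge> 0"
  proof (rule Re_nonneg_right_half_plane[where f = "\<lambda>s. (h 0 - h s) / s" and S = ?S and L = 0])
    show "(\<lambda>s. (h 0 - h s) / s) holomorphic_on - ?S"
      unfolding h_def
      by (intro holomorphic_intros holomorphic_on_subset[OF realization_holomorphic[OF real]]) auto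
    show "closed ?S" by (intro closed_insert closed_eigs)
    show "\<forall>\<^sub>F s in at p. s \<notin> ?S" for p
    proof -
      have "\<forall>\<^sub>F s in at p. s \<noteq> 0"
        using eventually_neq_at_within by blast
      then show ?thesis using eigs_eventually_at[of A p] by eventually_elim simp
    qed
    show "\<forall>\<^sub>F s in at_infinity. s \<notin> ?S"
      using eigs_eventually_at_infinity[of A] eventually_not_equal_at_infinity[of 0]
      by eventually_elim simp
    show "s \<notin> ?S" if "Re s > 0" for s using that no_eigs[of s] by auto
    show "Re ((h 0 - h s) / s) \<ge> 0" if s: "Re s = 0" "s \<notin> ?S" for s
    proof -
      have "Re (s * h s) \<ge> 0" unfolding h_def using s by (intro axis_nonneg) auto
      then show ?thesis using s h0 by (simp add: Re_divide algebra_simps divide_nonpos_nonneg)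
    qed
    \<comment> \<open>All residues vanish: \<open>H\<close> is regular on the axis and the
      singularity at 0 is removable.\<close>
    show "\<exists>k::real. k \<ge> 0 \<and> ((\<lambda>s. (s - p) * ((h 0 - h s) / s)) \<longlongrightarrow> of_real k) (at p)" if p: "Re p = 0" for p
    proof (intro exI[of _ 0] conjI)
      show "((\<lambda>s. (s - p) * ((h 0 - h s) / s)) \<longlongrightarrow> of_real 0) (at p)"
      proof (cases "p = 0")
        case True
        have "((\<lambda>s. h 0 - h s) \<longlongrightarrow> h 0 - h 0) (at 0)" by (intro tendsto_intros hlim) simp
        then have "((\<lambda>s. h 0 - h s) \<longlongrightarrow> of_real 0) (at 0)" by simp
        then show ?thesis unfolding True
          by (rule Lim_transform_eventually) (auto simp: eventually_at_filter)
      next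
        case False
        have "((\<lambda>s. (s - p) * ((h 0 - h s) / s)) \<longlongrightarrow> (p - p) * ((h 0 - h p) / p)) (at p)"
          by (intro tendsto_intros hlim p False)
        then show ?thesis by simp
      qed
    qed simp
    show "((\<lambda>s. (h 0 - h s) / s) \<longlongrightarrow> 0) at_infinity"
    proof (rule tendsto_divide_0[OF _ filterlim_ident])
      have "((\<lambda>s. sip y (cmat C *v resv A s (cmat B *v y) + cmat D *v y)) \<longlongrightarrow> sip y (cmat C *v 0 + cmat D *v y)) at_infinity"
        by (intro tendsto_intros resv_tendsto_0_at_infinity)
      moreover have "\<forall>\<^sub>F s in at_infinity. sip y (cmat C *v resv A s (cmat B *v y) + cmat D *v y) = h s"
        using eigs_eventually_at_infinity[of A] by eventually_elim (simp add: h_def realization_apply[OF real])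
      ultimately have "(h \<longlongrightarrow> sip y (cmat C *v 0 + cmat D *v y)) at_infinity"
        by (rule Lim_transform_eventually)
      then show "((\<lambda>s. h 0 - h s) \<longlongrightarrow> h 0 - sip y (cmat C *v 0 + cmat D *v y)) at_infinity"
        by (intro tendsto_intros)
    qed
  qed (rule z)
  then show ?thesis by (simp add: h_def)
qed

end

lemma cscale_zero: "cscale c 0 = 0"
  by (simp add: vec_eq_iff)

subsection \<open>Negative imaginary systems\<close>

locale ni_system =
  fixes G :: "complex \<Rightarrow> complex^'m^'m" and A :: "real^'n^'n" and B :: "real^'m^'n"
    and C :: "real^'n^'m"
  assumes minimal: "minimal_realization G A B C 0" and ni: "negative_imaginary G"
begin

lemma real: "realization G A B C 0"
  using minimal by (simp add: minimal_realization_def)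

lemma G_apply: "s \<notin> eigs A \<Longrightarrow> G s *v u = cmat C *v resv A s (cmat B *v u)"
  using realization_apply[OF real, of s u] by (simp add: cmat_zero)

lemma no_eigs: "Re s > 0 \<Longrightarrow> s \<notin> eigs A"
  using minimal_eigenvalue_is_pole[OF minimal] ni by (auto simp: negative_imaginary_def)

lemma no_pole: "s \<notin> eigs A \<Longrightarrow> \<not> has_pole G s"
  using no_pole_iff_limit[OF real] realization_tendsto[OF real] by blast

lemma axis_nonneg_upper:
  assumes "w > 0" "\<i> * of_real w \<notin> eigs A"
  shows "Im (sip u (G (\<i> * of_real w) *v u)) \<le> 0"
proof -
  have "herm_form (cscale \<i> (G (\<i> * of_real w) - ctranspose (G (\<i> * of_real w)))) u \<ge> 0"
    using ni assms no_pole unfolding negative_imaginary_def pos_semidef_def by blast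
  then show ?thesis by (simp only: herm_form_imaginary_part)
qed

lemma axis_nonneg:
  assumes s: "Re s = 0" "s \<notin> eigs A"
  shows "Re (s * sip u (G s *v u)) \<ge> 0"
proof (cases "Im s > 0")
  case True
  have "s = \<i> * of_real (Im s)" using s by (simp add: complex_eq_iff)
  then have "Im (sip u (G s *v u)) \<le> 0" using axis_nonneg_upper[OF True, of u] s(2) by simp
  then show ?thesis using s True by (simp add: mult_le_0_iff)
next
  case False
  define t where "t = \<i> * of_real (- Im s)"
  have t: "cnj t = s" using s by (simp add: t_def complex_eq_iff)
  then have te: "t \<notin> eigs A" using s(2) eigs_cnj[of t A] by simp
  have "Re (t * sip (vcnj u) (G t *v vcnj u)) \<ge> 0"
  proof (cases "Im s = 0")
    case False
    then have "Im (sip (vcnj u) (G t *v vcnj u)) \<le> 0"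
      using te \<open>\<not> Im s > 0\<close> unfolding t_def by (intro axis_nonneg_upper) auto
    then show ?thesis using \<open>\<not> Im s > 0\<close> by (simp add: t_def zero_le_mult_iff)
  qed (simp add: t_def)
  moreover have "sip (vcnj (vcnj u)) (G (cnj t) *v vcnj (vcnj u)) = cnj (sip (vcnj u) (G t *v vcnj u))"
    by (rule sip_realization_cnj[OF real te])
  then have "s * sip u (G s *v u) = cnj (t * sip (vcnj u) (G t *v vcnj u))" by (simp add: t)
  ultimately show ?thesis by simp
qed

lemma no_pole_residue:
  assumes "\<not> has_pole G p"
  shows "((\<lambda>s. cscale ((s - p) * s) (G s)) \<longlongrightarrow> 0) (at p)"
proof -
  obtain K where "(G \<longlongrightarrow> K) (at p)" using assms no_pole_iff_limit[OF real] by blast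
  then have "((\<lambda>s. cscale ((s - p) * s) (G s)) \<longlongrightarrow> cscale ((p - p) * p) K) (at p)"
    by (intro tendsto_cscale tendsto_intros)
  moreover have "cscale ((p - p) * p) K = 0" by (simp add: vec_eq_iff)
  ultimately show ?thesis by simp
qed

lemma residue_upper:
  assumes w: "w > 0"
  shows "\<exists>Q. pos_semidef Q \<and>
    ((\<lambda>s. cscale ((s - \<i> * of_real w) * s) (G s)) \<longlongrightarrow> Q) (at (\<i> * of_real w))"
proof (cases "has_pole G (\<i> * of_real w)")
  case True
  then obtain K where K: "((\<lambda>s. cscale ((s - \<i> * of_real w) * \<i>) (G s)) \<longlongrightarrow> K) (at (\<i> * of_real w))"
      "pos_semidef K"
    using ni w unfolding negative_imaginary_def by blast
  \<comment> \<open>Replacing the factor \<open>\<i>\<close> by \<open>s\<close> multiplies the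
    residue by \<open>w > 0\<close>.\<close>
  have "((\<lambda>s. cscale (s / \<i>) (cscale ((s - \<i> * of_real w) * \<i>) (G s))) \<longlongrightarrow> cscale (\<i> * of_real w / \<i>) K)
      (at (\<i> * of_real w))"
    by (intro tendsto_cscale tendsto_intros K) auto
  moreover have "cscale (s / \<i>) (cscale ((s - \<i> * of_real w) * \<i>) (G s)) = cscale ((s - \<i> * of_real w) * s) (G s)" for s
    by (simp add: vec_eq_iff algebra_simps)
  ultimately show ?thesis using pos_semidef_cscale[OF K(2), of w] w by auto
next
  case False
  then show ?thesis using no_pole_residue pos_semidef_zero by blast
qed

text \<open>These are the residues of s G(s) that the maximum principle asks for: a double pole of
  \<open>G\<close> at 0 becomes simple, and negative frequencies follow by conjugation.\<close>

lemma residue: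
  assumes p: "Re p = 0"
  shows "\<exists>Q. pos_semidef Q \<and> ((\<lambda>s. cscale ((s - p) * s) (G s)) \<longlongrightarrow> Q) (at p)"
proof -
  consider "p = 0" | "Im p > 0" | "Im p < 0" using p by (force simp: complex_eq_iff)
  then show ?thesis
  proof cases
    case 1
    show ?thesis
    proof (cases "has_pole G 0")
      case True
      then have "\<exists>K. ((\<lambda>s. cscale (s ^ 2) (G s)) \<longlongrightarrow> K) (at 0) \<and> pos_semidef K"
        using ni unfolding negative_imaginary_def by blast
      then show ?thesis using 1 by (auto simp: power2_eq_square)
    next
      case False
      then show ?thesis using no_pole_residue pos_semidef_zero 1 by blast
    qed
  next
    case 2
    have "p = \<i> * of_real (Im p)" using p by (simp add: complex_eq_iff)
    then show ?thesis using residue_upper[OF 2] by simp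
  next
    case 3
    have "cnj p = \<i> * of_real (- Im p)" using p by (simp add: complex_eq_iff)
    then obtain Q where Q: "pos_semidef Q" "((\<lambda>s. cscale ((s - cnj p) * s) (G s)) \<longlongrightarrow> Q) (at (cnj p))"
      using residue_upper[of "- Im p"] 3 by auto
    have "((\<lambda>s. map_matrix cnj (cscale ((cnj s - cnj p) * cnj s) (G (cnj s)))) \<longlongrightarrow> map_matrix cnj Q) (at p)"
    proof (intro vec_tendstoI)
      fix i j
      have "((\<lambda>s. cnj (cscale ((cnj s - cnj p) * cnj s) (G (cnj s)) $ i $ j)) \<longlongrightarrow> cnj (Q $ i $ j)) (at p)"
        by (intro tendsto_cnj tendsto_vec_nth filterlim_compose[OF Q(2) filterlim_cnj_at])
      then show "((\<lambda>s. map_matrix cnj (cscale ((cnj s - cnj p) * cnj s) (G (cnj s))) $ i $ j) \<longlongrightarrow> map_matrix cnj Q $ i $ j) (at p)"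
        by (simp only: nth_map_matrix)
    qed
    moreover have "\<forall>\<^sub>F s in at p. map_matrix cnj (cscale ((cnj s - cnj p) * cnj s) (G (cnj s))) = cscale ((s - p) * s) (G s)"
      using eigs_eventually_at[of A p]
    proof eventually_elim
      case (elim s)
      have "vcnj (axis q 1) = axis q 1" for q :: 'm by (simp add: vec_eq_iff axis_def)
      then have "G (cnj s) $ i $ j = cnj (G s $ i $ j)" for i j
        using realization_cnj[OF real elim, of "axis j 1"] by (metis mult_axis_component vcnj_simps(1))
      then show ?case by (simp add: vec_eq_iff)
    qed
    ultimately have "((\<lambda>s. cscale ((s - p) * s) (G s)) \<longlongrightarrow> map_matrix cnj Q) (at p)"
      by (rule Lim_transform_eventually)
    then show ?thesis using pos_semidef_cnj[OF Q(1)] by blast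
  qed
qed

lemma residue_apply:
  assumes "((\<lambda>s. cscale (c s) (G s)) \<longlongrightarrow> Q) (at p)"
  shows "((\<lambda>s. c s * sip w (G s *v u)) \<longlongrightarrow> sip w (Q *v u)) (at p)"
  using tendsto_sip[OF tendsto_const[of w] tendsto_matrix_apply[OF assms]]
  by (simp add: cscale_mult sip_simps)

lemma G_holomorphic: "(\<lambda>s. sip w (G s *v u)) holomorphic_on - eigs A"
  by (rule realization_holomorphic[OF real])

lemma positive_real:
  assumes z: "Re z > 0"
  shows "Re (z * sip u (G z *v u)) \<ge> 0"
proof (rule Re_nonneg_right_half_plane[where f = "\<lambda>s. s * sip u (G s *v u)" and S = "eigs A"
      and L = "sip u (cmat C *v (cmat B *v u))"])
  show "(\<lambda>s. s * sip u (G s *v u)) holomorphic_on - eigs A"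
    by (intro holomorphic_intros G_holomorphic)
  show "\<exists>k::real. k \<ge> 0 \<and> ((\<lambda>s. (s - p) * (s * sip u (G s *v u))) \<longlongrightarrow> of_real k) (at p)" if p: "Re p = 0" for p
  proof -
    obtain Q where Q: "pos_semidef Q" "((\<lambda>s. cscale ((s - p) * s) (G s)) \<longlongrightarrow> Q) (at p)"
      using residue[OF p] by blast
    obtain k :: real where "k \<ge> 0" "sip u (Q *v u) = of_real k" using pos_semidef_sip[OF Q(1)] by blast
    then show ?thesis using residue_apply[OF Q(2), of u u] by (auto simp: mult.assoc)
  qed
  show "((\<lambda>s. s * sip u (G s *v u)) \<longlongrightarrow> sip u (cmat C *v (cmat B *v u))) at_infinity"
  proof (rule Lim_transform_eventually)
    show "((\<lambda>s. sip u (cmat C *v (s *s resv A s (cmat B *v u)))) \<longlongrightarrow> sip u (cmat C *v (cmat B *v u))) at_infinity"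
      by (intro tendsto_sip tendsto_const tendsto_matrix_vector_mult scaled_resv_tendsto_at_infinity)
    show "\<forall>\<^sub>F s in at_infinity. sip u (cmat C *v (s *s resv A s (cmat B *v u))) = s * sip u (G s *v u)"
      using eigs_eventually_at_infinity[of A]
      by eventually_elim (simp add: G_apply matrix_vector_mult_scale sip_simps)
  qed
qed (use z closed_eigs eigs_eventually_at eigs_eventually_at_infinity no_eigs axis_nonneg in auto)

text \<open>The pole order seen through \<open>w\<close> passes from inputs
  \<open>cmat B *v u\<close> to arbitrary initial states \<open>x\<close>.\<close>

lemma output_order:
  assumes d: "d > 0" and lim: "\<And>u. ((\<lambda>s. (s - p) ^ d * sip w (G s *v u)) \<longlongrightarrow> 0) (at p)"
  shows "((\<lambda>s. (s - p) ^ d * sip w (cmat C *v resv A s x)) \<longlongrightarrow> 0) (at p)"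
  unfolding sip_ctranspose[of w "cmat C"]
proof (rule minimal_resolvent_order[OF minimal d])
  fix u
  show "((\<lambda>s. (s - p) ^ d * sip (ctranspose (cmat C) *v w) (resv A s (cmat B *v u))) \<longlongrightarrow> 0) (at p)"
    using lim[of u]
  proof (rule Lim_transform_eventually)
    show "\<forall>\<^sub>F s in at p. (s - p) ^ d * sip w (G s *v u) =
        (s - p) ^ d * sip (ctranspose (cmat C) *v w) (resv A s (cmat B *v u))"
      using eigs_eventually_at[of A p]
      by eventually_elim (simp add: G_apply flip: sip_ctranspose[of w "cmat C"])
  qed
qed

text \<open>If \<open>p\<close> is an eigenvalue, \<open>u\<close> does not determine the state.
  Rewriting the equation as sx = Ax + Bu + (s - p)x compares the output with G(s)u at regular points
  \<open>s\<close> near \<open>p\<close>.\<close>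

lemma output_expansion:
  assumes x: "p *s x = cmat A *v x + cmat B *v u" and s: "s \<notin> eigs A"
  shows "cmat C *v x = G s *v u + (s - p) *s (cmat C *v resv A s x)"
proof -
  have "s *s x = cmat A *v x + (cmat B *v u + (s - p) *s x)"
    using x by (simp add: vec_eq_iff algebra_simps)
  then have "x = resv A s (cmat B *v u + (s - p) *s x)" by (rule resv_unique[OF s])
  then have "cmat C *v x = cmat C *v resv A s (cmat B *v u + (s - p) *s x)" by simp
  then show ?thesis
    by (simp add: resv_simps G_apply[OF s] matrix_vector_right_distrib matrix_vector_mult_scale
        matrix_vector_mult_diff_distrib vector_sub_rdistrib)
qed

text \<open>If \<open>p\<close> is an eigenvalue of \<open>A\<close>, then the residue annihilates \<open>u\<close>, and the homogeneous part
  of the output is invisible to \<open>u\<close>.\<close>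

lemma axis_state_nonneg:
  assumes p: "Re p = 0" "p \<noteq> 0" and x: "p *s x = cmat A *v x + cmat B *v u"
  shows "Re (p * sip u (cmat C *v x)) \<ge> 0"
proof -
  let ?y = "cmat C *v x"
  obtain Q where Q: "pos_semidef Q" "((\<lambda>s. cscale ((s - p) * s) (G s)) \<longlongrightarrow> Q) (at p)"
    using residue[OF p(1)] by blast
  have nz: "\<forall>\<^sub>F s in at p. s \<noteq> 0" using p(2) by (intro eventually_at_topological[THEN iffD2] exI[of _ "- {0}"]) auto
  have one: "((\<lambda>s. (s - p) * sip w (G s *v v)) \<longlongrightarrow> sip w (Q *v v) / p) (at p)" for w v
  proof (rule Lim_transform_eventually)
    show "((\<lambda>s. (s - p) * s * sip w (G s *v v) / s) \<longlongrightarrow> sip w (Q *v v) / p) (at p)"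
      by (intro tendsto_divide residue_apply Q tendsto_ident_at p)
    show "\<forall>\<^sub>F s in at p. (s - p) * s * sip w (G s *v v) / s = (s - p) * sip w (G s *v v)"
      using nz by eventually_elim simp
  qed
  \<comment> \<open>The pole of \<open>G\<close> at \<open>p\<close> is at most simple, so one
    further factor makes the state response vanish in the limit.\<close>
  have two: "((\<lambda>s. (s - p) ^ 2 * sip w (cmat C *v resv A s x)) \<longlongrightarrow> 0) (at p)" for w
  proof (rule output_order)
    fix v
    have "((\<lambda>s. (s - p) * ((s - p) * sip w (G s *v v))) \<longlongrightarrow> (p - p) * (sip w (Q *v v) / p)) (at p)"
      by (intro tendsto_mult one tendsto_intros)
    then show "((\<lambda>s. (s - p) ^ 2 * sip w (G s *v v)) \<longlongrightarrow> 0) (at p)" by (simp add: power2_eq_square mult.assoc)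
  qed simp
  \<comment> \<open>Multiplying the output expansion by \<open>s - p\<close> isolates the residue
    applied to \<open>u\<close>.\<close>
  have "sip w (Q *v u) = 0" for w
  proof -
    have "((\<lambda>s. (s - p) * sip w ?y - (s - p) ^ 2 * sip w (cmat C *v resv A s x)) \<longlongrightarrow> (p - p) * sip w ?y - 0) (at p)"
      by (intro tendsto_diff two tendsto_intros)
    moreover have "\<forall>\<^sub>F s in at p. (s - p) * sip w ?y - (s - p) ^ 2 * sip w (cmat C *v resv A s x) = (s - p) * sip w (G s *v u)"
      using eigs_eventually_at[of A p]
      by eventually_elim (simp add: output_expansion[OF x] sip_simps algebra_simps power2_eq_square)
    ultimately have "((\<lambda>s. (s - p) * sip w (G s *v u)) \<longlongrightarrow> (p - p) * sip w ?y - 0) (at p)"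
      by (rule Lim_transform_eventually)
    from tendsto_unique[OF _ this one] show ?thesis using p(2) by simp
  qed
  \<comment> \<open>As \<open>Q\<close> is Hermitian, \<open>u\<close> annihilates it from the left
    too, which lowers the order seen through \<open>u\<close> to \<open>d = 1\<close>.\<close>
  then have "sip u (Q *v v) = 0" for v
    using hermitian_sip[of Q u v] Q(1) by (simp add: pos_semidef_def)
  then have "((\<lambda>s. (s - p) ^ 1 * sip u (cmat C *v resv A s x)) \<longlongrightarrow> 0) (at p)"
    using one[of u] by (intro output_order) auto
  then have "((\<lambda>s. s * (sip u ?y - (s - p) * sip u (cmat C *v resv A s x))) \<longlongrightarrow> p * (sip u ?y - 0)) (at p)"
    by (intro tendsto_intros) simp
  moreover have "\<forall>\<^sub>F s in at p. s * (sip u ?y - (s - p) * sip u (cmat C *v resv A s x)) = s * sip u (G s *v u)"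
    using eigs_eventually_at[of A p] by eventually_elim (simp add: output_expansion[OF x] sip_simps algebra_simps)
  ultimately have "((\<lambda>s. s * sip u (G s *v u)) \<longlongrightarrow> p * (sip u ?y - 0)) (at p)"
    by (rule Lim_transform_eventually)
  then have "0 \<le> Re (p * (sip u ?y - 0))"
  proof (rule Re_tendsto_nonneg_imaginary_axis[OF _ p(1)])
    show "\<forall>\<^sub>F s in at p. Re s = 0 \<longrightarrow> Re (s * sip u (G s *v u)) \<ge> 0"
      using eigs_eventually_at[of A p] by eventually_elim (intro impI axis_nonneg)
  qed
  then show ?thesis by simp
qed

text \<open>A \<open>Lim\<close> carries information only once the limit exists;
  \<open>residue\<close> at 0 supplies it, whether or not 0 is a pole.\<close>

lemma coeff2_limit: "((\<lambda>s. cscale (s ^ 2) (G s)) \<longlongrightarrow> coeff2 G) (at 0)"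
  and coeff2_pos_semidef: "pos_semidef (coeff2 G)"
proof -
  obtain Q where Q: "pos_semidef Q" "((\<lambda>s. cscale ((s - 0) * s) (G s)) \<longlongrightarrow> Q) (at 0)"
    using residue[of 0] by auto
  then have lim: "((\<lambda>s. cscale (s ^ 2) (G s)) \<longlongrightarrow> Q) (at 0)" by (simp add: power2_eq_square)
  then have "coeff2 G = Q" unfolding coeff2_def by (intro tendsto_Lim) auto
  then show "((\<lambda>s. cscale (s ^ 2) (G s)) \<longlongrightarrow> coeff2 G) (at 0)" "pos_semidef (coeff2 G)"
    using lim Q by auto
qed

text \<open>Multiply the output expansion at \<open>p = 0\<close> by the square of \<open>s\<close>.
  The pole of \<open>G\<close> has order at most two, so in the limit only the leading coefficient
  applied to \<open>u\<close> remains.\<close>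

lemma coeff2_input_zero:
  assumes x: "cmat A *v x + cmat B *v u = 0"
  shows "coeff2 G *v u = 0"
proof (rule sip_eq_0_all)
  fix w
  have x': "0 *s x = cmat A *v x + cmat B *v u" using x by simp
  have G2: "((\<lambda>s. s\<^sup>2 * sip w (G s *v v)) \<longlongrightarrow> sip w (coeff2 G *v v)) (at 0)" for v
    by (rule residue_apply[OF coeff2_limit])
  have "((\<lambda>s. (s - 0) ^ 3 * sip w (cmat C *v resv A s x)) \<longlongrightarrow> 0) (at 0)"
  proof (rule output_order)
    fix v
    have "((\<lambda>s. s * (s\<^sup>2 * sip w (G s *v v))) \<longlongrightarrow> 0 * sip w (coeff2 G *v v)) (at 0)"
      by (intro tendsto_mult G2 tendsto_ident_at)
    then show "((\<lambda>s. (s - 0) ^ 3 * sip w (G s *v v)) \<longlongrightarrow> 0) (at 0)"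
      by (simp add: power2_eq_square power3_eq_cube mult.assoc)
  qed simp
  then have "((\<lambda>s. s\<^sup>2 * sip w (cmat C *v x) - (s - 0) ^ 3 * sip w (cmat C *v resv A s x)) \<longlongrightarrow> 0\<^sup>2 * sip w (cmat C *v x) - 0) (at 0)"
    by (intro tendsto_intros)
  moreover have "\<forall>\<^sub>F s in at 0. s\<^sup>2 * sip w (cmat C *v x) - (s - 0) ^ 3 * sip w (cmat C *v resv A s x) = s\<^sup>2 * sip w (G s *v u)"
    using eigs_eventually_at[of A 0]
    by eventually_elim (simp add: output_expansion[OF x'] sip_simps algebra_simps power2_eq_square power3_eq_cube)
  ultimately have "((\<lambda>s. s\<^sup>2 * sip w (G s *v u)) \<longlongrightarrow> 0\<^sup>2 * sip w (cmat C *v x) - 0) (at 0)"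
    by (rule Lim_transform_eventually)
  from tendsto_unique[OF _ this G2] show "sip w (coeff2 G *v u) = 0" by simp
qed

end

section \<open>Laurent expansion at 0 with vanishing \<open>G\<^sub>1\<close>\<close>

locale ni_double_integrator = ni_system +
  assumes coeff1: "coeff1 G = 0"
begin

text \<open>Two removals of a simple pole: from s G(s), whose remainder tends to
  \<open>coeff1 G = 0\<close>, and then from what is left of \<open>G\<close>.\<close>

lemma coeff0_limit: "((\<lambda>s. G s - cscale (1 / s ^ 2) (coeff2 G)) \<longlongrightarrow> coeff0 G) (at 0)"
proof -
  obtain r where r: "r > 0" "\<And>s. s \<in> ball 0 r - {0} \<Longrightarrow> s \<notin> eigs A"
    using punctured_holomorphicE[OF G_holomorphic closed_eigs eigs_eventually_at] by blast
  have hol: "(\<lambda>s. G s $ i $ j) holomorphic_on ball 0 r - {0}" for i j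
    unfolding realization_component_sip
    by (rule holomorphic_on_subset[OF G_holomorphic]) (use r(2) in auto)
  let ?k = "\<lambda>i j. coeff2 G $ i $ j"
  have "\<exists>L. ((\<lambda>s. s * (G s $ i $ j - ?k i j / s\<^sup>2)) \<longlongrightarrow> L) (at 0)" for i j
  proof -
    have "((\<lambda>s. cscale (s ^ 2) (G s) $ i $ j) \<longlongrightarrow> ?k i j) (at 0)"
      by (intro tendsto_vec_nth coeff2_limit)
    then have "((\<lambda>s. (s - 0) * (s * G s $ i $ j)) \<longlongrightarrow> ?k i j) (at 0)"
      by (simp add: power2_eq_square mult.assoc)
    then obtain L where L: "((\<lambda>s. s * G s $ i $ j - ?k i j / (s - 0)) \<longlongrightarrow> L) (at 0)"
      by (rule simple_pole_remainder_tendsto[rotated 2]) (use r(1) in \<open>auto intro!: holomorphic_intros hol\<close>)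
    have "\<forall>\<^sub>F s in at 0. s * G s $ i $ j - ?k i j / (s - 0) = s * (G s $ i $ j - ?k i j / s\<^sup>2)"
      by (auto simp: eventually_at_filter field_simps power2_eq_square)
    from Lim_transform_eventually[OF L this] show ?thesis ..
  qed
  then have "\<forall>i. \<exists>f. \<forall>j. ((\<lambda>s. s * (G s $ i $ j - ?k i j / s\<^sup>2)) \<longlongrightarrow> f j) (at 0)"
    by (intro allI choice)
  from choice[OF this] obtain L where L: "\<And>i j. ((\<lambda>s. s * (G s $ i $ j - ?k i j / s\<^sup>2)) \<longlongrightarrow> L i j) (at 0)"
    by blast
  have "((\<lambda>s. cscale s (G s - cscale (1 / s ^ 2) (coeff2 G))) \<longlongrightarrow> (\<chi> i j. L i j)) (at 0)"
    using L by (intro vec_tendstoI) simp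
  then have "coeff1 G = (\<chi> i j. L i j)"
    unfolding coeff1_def by (intro tendsto_Lim) auto
  then have L0: "L i j = 0" for i j using coeff1 by (simp add: vec_eq_iff)
  have "\<exists>M. ((\<lambda>s. G s $ i $ j - ?k i j / s\<^sup>2) \<longlongrightarrow> M) (at 0)" for i j
  proof -
    have "((\<lambda>s. (s - 0) * (G s $ i $ j - ?k i j / s\<^sup>2)) \<longlongrightarrow> 0) (at 0)" using L[of i j] L0 by simp
    then obtain M where "((\<lambda>s. G s $ i $ j - ?k i j / s\<^sup>2 - 0 / (s - 0)) \<longlongrightarrow> M) (at 0)"
      by (rule simple_pole_remainder_tendsto[rotated 2]) (use r(1) in \<open>auto intro!: holomorphic_intros hol\<close>)
    then show ?thesis by auto
  qed
  then have "\<forall>i. \<exists>f. \<forall>j. ((\<lambda>s. G s $ i $ j - ?k i j / s\<^sup>2) \<longlongrightarrow> f j) (at 0)"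
    by (intro allI choice)
  from choice[OF this] obtain M where M: "\<And>i j. ((\<lambda>s. G s $ i $ j - ?k i j / s\<^sup>2) \<longlongrightarrow> M i j) (at 0)"
    by blast
  have lim: "((\<lambda>s. G s - cscale (1 / s ^ 2) (coeff2 G)) \<longlongrightarrow> (\<chi> i j. M i j)) (at 0)"
    using M by (intro vec_tendstoI) simp
  then have "coeff0 G = (\<chi> i j. M i j)"
    unfolding coeff0_def coeff1 cscale_zero by (intro tendsto_Lim) auto
  then show ?thesis using lim by simp
qed

text \<open>On the imaginary axis the subtracted term is a real multiple of a Hermitian matrix, so
  the NI sign survives; since \<open>K\<close> is real, so does conjugation symmetry.\<close>

lemma coeff0_hermitian:
  assumes k: "coeff2 G = cmat K"
  shows "hermitian (coeff0 G)"
proof (rule hermitian_limit_at_0[OF coeff0_limit])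
  show "\<forall>\<^sub>F s in at 0. \<forall>x. (G (cnj s) - cscale (1 / (cnj s)\<^sup>2) (coeff2 G)) *v vcnj x =
      vcnj ((G s - cscale (1 / s\<^sup>2) (coeff2 G)) *v x)"
    using eigs_eventually_at[of A 0]
  proof eventually_elim
    case (elim s)
    show ?case
      by (simp add: k matrix_vector_mult_diff_rdistrib cscale_mult realization_cnj[OF real elim] cmat_vcnj)
         (simp add: vec_eq_iff)
  qed
  have "\<forall>\<^sub>F t in at_right 0. \<i> * of_real t \<notin> eigs A"
    by (rule eventually_compose_filterlim[OF eigs_eventually_at filterlim_imaginary_at_right])
  moreover have "\<forall>\<^sub>F t in at_right (0::real). t > 0" by (simp add: eventually_at_filter)
  ultimately show "\<forall>\<^sub>F t in at_right (0::real). \<forall>x.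
      Im (sip x ((G (\<i> * of_real t) - cscale (1 / (\<i> * of_real t)\<^sup>2) (coeff2 G)) *v x)) \<le> 0"
  proof eventually_elim
    case (elim t)
    show ?case
    proof
      fix x
      obtain c :: real where "sip x (coeff2 G *v x) = of_real c"
        using pos_semidef_sip[OF coeff2_pos_semidef] by blast
      then have "Im (1 / (\<i> * of_real t)\<^sup>2 * sip x (coeff2 G *v x)) = 0"
        by (simp add: power_mult_distrib Im_divide flip: of_real_power of_real_minus)
      moreover have "Im (sip x (G (\<i> * of_real t) *v x)) \<le> 0" using elim by (intro axis_nonneg_upper)
      ultimately show "Im (sip x ((G (\<i> * of_real t) - cscale (1 / (\<i> * of_real t)\<^sup>2) (coeff2 G)) *v x)) \<le> 0"
        by (simp add: matrix_vector_mult_diff_rdistrib cscale_mult sip_simps)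
    qed
  qed
qed

end

section \<open>Directions annihilated by \<open>G\<^sub>2\<close> and
  \<open>G\<^sub>0\<close>\<close>

locale ni_null_direction = ni_double_integrator +
  fixes w
  assumes w2: "coeff2 G *v w = 0" and w0: "\<And>u. sip w (coeff0 G *v u) = 0" and sym: "hermitian (coeff0 G)"
begin

lemma w2': "sip w (coeff2 G *v u) = 0"
  using hermitian_sip[of "coeff2 G" w u] coeff2_pos_semidef w2 by (simp add: pos_semidef_def sip_simps)

lemma left_limit: "((\<lambda>s. sip w (G s *v u)) \<longlongrightarrow> 0) (at 0)"
proof -
  have "((\<lambda>s. sip w ((G s - cscale (1 / s ^ 2) (coeff2 G)) *v u)) \<longlongrightarrow> sip w (coeff0 G *v u)) (at 0)"
    by (intro tendsto_sip tendsto_const tendsto_matrix_apply coeff0_limit)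
  then show ?thesis by (simp add: matrix_vector_mult_diff_rdistrib cscale_mult sip_simps w2' w0)
qed

lemma right_limit: "((\<lambda>s. sip u (G s *v w)) \<longlongrightarrow> 0) (at 0)"
proof -
  have "((\<lambda>s. sip u ((G s - cscale (1 / s ^ 2) (coeff2 G)) *v w)) \<longlongrightarrow> sip u (coeff0 G *v w)) (at 0)"
    by (intro tendsto_sip tendsto_const tendsto_matrix_apply coeff0_limit)
  moreover have "sip u (coeff0 G *v w) = 0" using hermitian_sip[OF sym, of u w] w0 by simp
  ultimately show ?thesis by (simp add: matrix_vector_mult_diff_rdistrib cscale_mult sip_simps w2)
qed

text \<open>First \<open>s w\<^sup>*G(s)w\<close> vanishes near 0 because of its double boundary zero; then \<open>w\<close> is isotropic
  for a positive semidefinite form, so the cross terms have vanishing real part, and the same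
  argument applies to them.\<close>

lemma left_zero:
  assumes z: "Re z > 0"
  shows "sip w (G z *v u) = 0"
proof -
  obtain r where r: "r > 0" "\<And>s. s \<in> ball 0 r - {0} \<Longrightarrow> s \<notin> eigs A"
    using punctured_holomorphicE[OF G_holomorphic closed_eigs eigs_eventually_at] by blast
  have hol: "(\<lambda>s. sip a (G s *v b)) holomorphic_on ball 0 r - {0}" for a b
    by (rule holomorphic_on_subset[OF G_holomorphic]) (use r(2) in auto)
  have diag: "s * sip w (G s *v w) = 0" if s: "s \<in> ball 0 r - {0}" for s
  proof (rule Re_nonneg_double_boundary_zero[where f = "\<lambda>s. s * sip w (G s *v w)" and r = r])
    show "(\<lambda>s. s * sip w (G s *v w)) holomorphic_on ball 0 r - {0}" by (intro holomorphic_intros hol)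
    show "((\<lambda>s. s * sip w (G s *v w) / s) \<longlongrightarrow> 0) (at 0)"
      by (rule Lim_transform_eventually[OF left_limit[of w]]) (auto simp: eventually_at_filter)
  qed (use r(1) s positive_real in auto)
  have cross: "s * (sip w (G s *v v) + sip v (G s *v w)) = 0" if s: "s \<in> ball 0 r - {0}" for s v
  proof (rule Re_nonneg_double_boundary_zero[where f = "\<lambda>s. s * (sip w (G s *v v) + sip v (G s *v w))" and r = r])
    show "(\<lambda>s. s * (sip w (G s *v v) + sip v (G s *v w))) holomorphic_on ball 0 r - {0}"
      by (intro holomorphic_intros hol)
    have "((\<lambda>s. sip w (G s *v v) + sip v (G s *v w)) \<longlongrightarrow> 0 + 0) (at 0)"
      by (intro tendsto_add left_limit right_limit)
    then have "((\<lambda>s. sip w (G s *v v) + sip v (G s *v w)) \<longlongrightarrow> 0) (at 0)" by simp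
    then show "((\<lambda>s. s * (sip w (G s *v v) + sip v (G s *v w)) / s) \<longlongrightarrow> 0) (at 0)"
      by (rule Lim_transform_eventually) (auto simp: eventually_at_filter)
    show "Re (s * (sip w (G s *v v) + sip v (G s *v w))) \<ge> 0" if s: "s \<in> ball 0 r" "Re s > 0" for s
    proof -
      let ?b = "Re (s * (sip w (G s *v v) + sip v (G s *v w)))"
      have d0: "s * sip w (G s *v w) = 0" using s by (intro diag) auto
      \<comment> \<open>Expand positive realness at \<open>w + t v\<close>: \<open>diag\<close>
        removes the constant term, so the linear one must vanish.\<close>
      have "0 \<le> ?b * t + Re (s * sip v (G s *v v)) * t\<^sup>2" for t :: real
      proof -
        let ?x = "w + of_real t *s v"
        have "0 \<le> Re (s * sip ?x (G s *v ?x))" by (rule positive_real[OF s(2)])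
        also have "s * sip ?x (G s *v ?x) = s * sip w (G s *v w)
            + of_real t * (s * (sip w (G s *v v) + sip v (G s *v w))) + of_real (t\<^sup>2) * (s * sip v (G s *v v))"
          by (simp add: sip_simps matrix_vector_right_distrib matrix_vector_mult_scale algebra_simps power2_eq_square)
        finally show ?thesis using d0 by (simp add: mult.commute del: of_real_power)
      qed
      then have "?b = 0" by (rule linear_term_eq_0)
      then show ?thesis by linarith
    qed
  qed (use r(1) s in auto)
  \<comment> \<open>Using \<open>cross\<close> at \<open>v\<close> and at \<open>\<i> *s v\<close>
    gives both the sum and the difference of the two cross terms.\<close>
  have near: "sip w (G s *v v) = 0" if s: "s \<in> ball 0 r - {0}" for s v
  proof -
    have "sip w (G s *v v) + sip v (G s *v w) = 0" using cross[OF s, of v] s by simp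
    moreover have "\<i> * (sip w (G s *v v) - sip v (G s *v w)) = 0"
      using cross[OF s, of "\<i> *s v"] s
      by (simp add: sip_simps matrix_vector_mult_scale right_diff_distrib)
    ultimately show ?thesis by simp
  qed
  \<comment> \<open>The identity theorem extends the vanishing from near 0 to the whole half
    plane.\<close>
  show ?thesis
  proof (rule analytic_continuation_open[where s = "{s. Re s > 0} \<inter> ball 0 r" and s' = "{s. Re s > 0}"
        and f = "\<lambda>s. sip w (G s *v u)" and g = "\<lambda>_. 0"])
    have "of_real (r / 2) \<in> {s. Re s > 0} \<inter> ball 0 r" using r(1) by simp
    then show "{s. Re s > 0} \<inter> ball 0 r \<noteq> {}" by blast
    show "(\<lambda>s. sip w (G s *v u)) holomorphic_on {s. Re s > 0}"
      by (rule holomorphic_on_subset[OF G_holomorphic]) (use no_eigs in auto)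
    show "connected {s. Re s > 0}" by (intro convex_connected convex_halfspace_Re_gt)
    show "sip w (G s *v u) = 0" if "s \<in> {s. Re s > 0} \<inter> ball 0 r" for s
      using that by (intro near) auto
  qed (use z in \<open>auto intro: open_halfspace_Re_gt open_Int\<close>)
qed

text \<open>At 0, where \<open>A\<close> may be singular, the output is compared with G(s)u for
  \<open>s\<close> near 0; seen through \<open>w\<close>, the state response has no pole of order
  one or more, after the factor \<open>s\<close>, to contribute in the limit.\<close>

lemma left_zero_state:
  assumes x: "cmat A *v x + cmat B *v u = 0"
  shows "sip w (cmat C *v x) = 0"
proof -
  have x': "0 *s x = cmat A *v x + cmat B *v u" using x by simp
  have "((\<lambda>s. (s - 0) ^ 1 * sip w (cmat C *v resv A s x)) \<longlongrightarrow> 0) (at 0)"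
  proof (rule output_order)
    fix v
    have "((\<lambda>s. (s - 0) ^ 1 * sip w (G s *v v)) \<longlongrightarrow> (0 - 0) ^ 1 * 0) (at 0)"
      by (intro tendsto_intros left_limit)
    then show "((\<lambda>s. (s - 0) ^ 1 * sip w (G s *v v)) \<longlongrightarrow> 0) (at 0)" by simp
  qed simp
  then have "((\<lambda>s. sip w (G s *v u) + (s - 0) ^ 1 * sip w (cmat C *v resv A s x)) \<longlongrightarrow> 0 + 0) (at 0)"
    by (intro tendsto_add left_limit)
  moreover have "\<forall>\<^sub>F s in at 0. sip w (G s *v u) + (s - 0) ^ 1 * sip w (cmat C *v resv A s x) = sip w (cmat C *v x)"
    using eigs_eventually_at[of A 0] by eventually_elim (simp add: output_expansion[OF x'] sip_simps)
  ultimately have "((\<lambda>s. sip w (cmat C *v x)) \<longlongrightarrow> 0 + 0) (at (0::complex))"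
    by (rule Lim_transform_eventually)
  then show ?thesis by (simp add: tendsto_const_iff)
qed

end

subsection \<open>The closed loop\<close>

definition vec_Inl :: "complex^('n::finite + 'k::finite) \<Rightarrow> complex^'n" where
  "vec_Inl v = (\<chi> i. v $ Inl i)"

definition vec_Inr :: "complex^('n::finite + 'k::finite) \<Rightarrow> complex^'k" where
  "vec_Inr v = (\<chi> i. v $ Inr i)"

definition inject_Inl :: "complex^'n \<Rightarrow> complex^('n::finite + 'k::finite)" where
  "inject_Inl x = (\<chi> i. case i of Inl a \<Rightarrow> x $ a | Inr _ \<Rightarrow> 0)"

definition project_Inl :: "complex^('n::finite + 'k::finite)^'n" where
  "project_Inl = (\<chi> i j. case j of Inl a \<Rightarrow> (if a = i then 1 else 0) | Inr _ \<Rightarrow> 0)"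

lemma sum_sum_type: "(\<Sum>i\<in>UNIV. f (i :: 'n::finite + 'k::finite)) = (\<Sum>i\<in>UNIV. f (Inl i)) + (\<Sum>i\<in>UNIV. f (Inr i))"
  unfolding UNIV_Plus_UNIV[symmetric] by (subst sum.Plus) auto

lemma vec_sum_simps:
  "vec_Inl (v + w) = vec_Inl v + vec_Inl w" "vec_Inr (v + w) = vec_Inr v + vec_Inr w"
  "vec_Inl (c *s v) = c *s vec_Inl v" "vec_Inr (c *s v) = c *s vec_Inr v"
  "vec_Inl (inject_Inl x) = x" "vec_Inr (inject_Inl x) = 0"
  by (simp_all add: vec_Inl_def vec_Inr_def inject_Inl_def vec_eq_iff)

lemma vec_sum_eq_0_iff: "v = 0 \<longleftrightarrow> vec_Inl v = 0 \<and> vec_Inr v = 0"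
proof -
  have "v $ i = 0" if "vec_Inl v = 0" "vec_Inr v = 0" for i
    using that by (cases i) (auto simp: vec_Inl_def vec_Inr_def vec_eq_iff)
  then show ?thesis by (auto simp: vec_Inl_def vec_Inr_def vec_eq_iff)
qed

lemma project_Inl_mult: "project_Inl *v v = vec_Inl v"
proof -
  have "(\<Sum>a\<in>UNIV. (if a = i then 1 else 0) * v $ Inl a) = v $ Inl i" for i
    by (simp add: if_distrib[of "\<lambda>x. x * _"] cong: if_cong)
  then show ?thesis
    by (simp add: vec_eq_iff project_Inl_def vec_Inl_def matrix_vector_mult_def sum_sum_type)
qed

lemma block_matrix_mult:
  "vec_Inl (cmat (block_matrix P Q R S) *v v) = cmat P *v vec_Inl v + cmat Q *v vec_Inr v"
  "vec_Inr (cmat (block_matrix P Q R S) *v v) = cmat R *v vec_Inl v + cmat S *v vec_Inr v"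
  by (simp_all add: vec_eq_iff vec_Inl_def vec_Inr_def matrix_vector_mult_def block_matrix_def sum_sum_type)

text \<open>For a strictly proper plant the inner inverse is the identity; the bracket is the
  controller output fed back to the plant.\<close>

lemma closed_loop_mult:
  fixes A :: "real^'n^'n" and A' :: "real^'k^'k" and v :: "complex^('n + 'k)"
  shows "vec_Inl (cmat (closed_loop_matrix A B C 0 A' B' C' D') *v v) =
      cmat A *v vec_Inl v + cmat B *v (cmat D' *v (cmat C *v vec_Inl v) + cmat C' *v vec_Inr v)"
    and "vec_Inr (cmat (closed_loop_matrix A B C 0 A' B' C' D') *v v) =
      cmat B' *v (cmat C *v vec_Inl v) + cmat A' *v vec_Inr v"
proof -
  have inv: "matrix_inv (mat 1) = (mat 1 :: real^'m^'m)"
    using matrix_inv_mult_vec(1)[of "mat 1 :: real^'m^'m"]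
    by (simp add: matrix_eq invertible_iff_inj)
  have "closed_loop_matrix A B C 0 A' B' C' D' = block_matrix (A + B ** D' ** C) (B ** C') (B' ** C) A'"
    by (simp add: closed_loop_matrix_def inv matrix_mul_rid)
  then show "vec_Inl (cmat (closed_loop_matrix A B C 0 A' B' C' D') *v v) =
      cmat A *v vec_Inl v + cmat B *v (cmat D' *v (cmat C *v vec_Inl v) + cmat C' *v vec_Inr v)"
    "vec_Inr (cmat (closed_loop_matrix A B C 0 A' B' C' D') *v v) =
      cmat B' *v (cmat C *v vec_Inl v) + cmat A' *v vec_Inr v"
    by (simp_all add: block_matrix_mult cmat_add cmat_mult matrix_vector_mult_add_rdistrib
        matrix_vector_right_distrib matrix_vector_mul_assoc[symmetric])
qed

lemma hurwitz_iff: "hurwitz A \<longleftrightarrow> (\<forall>s\<in>eigs A. Re s < 0)"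
  unfolding hurwitz_def Ball_def eigs_iff by blast

lemma transpose_cmat_eq: "transpose (cmat J) = ctranspose (cmat J)"
  by (simp add: ctranspose_cmat cmat_transpose)

text \<open>\<open>K\<close> inverts the Gram matrix of \<open>J\<close>, which is injective because
  its quadratic form is the squared norm of \<open>J *v x\<close>. This is done over the reals and
  then complexified.\<close>

lemma full_column_rank_right_inverse:
  fixes J :: "real^'r^'m"
  assumes "rank J = CARD('r)"
  obtains K :: "complex^'r^'r"
  where "\<And>x. K *v (ctranspose (cmat J) *v (cmat J *v x)) = x"
    "\<And>x. ctranspose (cmat J) *v (cmat J *v (K *v x)) = x"
proof -
  have inj: "inj ((*v) J)" using assms by (simp add: full_rank_injective)
  have "x = 0" if "(transpose J ** J) *v x = 0" for x
  proof -
    have "(J *v x) \<bullet> (J *v x) = x \<bullet> (transpose J *v (J *v x))"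
      by (metis dot_lmul_matrix inner_commute transpose_matrix_vector)
    also have "transpose J *v (J *v x) = 0"
      using that by (simp only: matrix_vector_mul_assoc)
    finally have "J *v x = J *v 0" by simp
    then show ?thesis using inj by (simp only: inj_eq)
  qed
  then have "invertible (transpose J ** J)" by (simp only: invertible_iff_inj) blast
  then obtain N where N: "(transpose J ** J) ** N = mat 1" "N ** (transpose J ** J) = mat 1"
    unfolding invertible_def by blast
  show ?thesis
  proof (rule that[of "cmat N"])
    show "cmat N *v (ctranspose (cmat J) *v (cmat J *v x)) = x" for x
      using arg_cong[OF N(2), of "\<lambda>M. cmat M *v x"]
      by (simp only: ctranspose_cmat cmat_mult cmat_one matrix_vector_mul_assoc matrix_mul_assoc matrix_vector_mul_lid)
    show "ctranspose (cmat J) *v (cmat J *v (cmat N *v x)) = x" for x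
      using arg_cong[OF N(1), of "\<lambda>M. cmat M *v x"]
      by (simp only: ctranspose_cmat cmat_mult cmat_one matrix_vector_mul_assoc matrix_mul_assoc matrix_vector_mul_lid)
  qed
qed

text \<open>Surjectivity gives injectivity, so the witness \<open>z\<close> is the only preimage and
  the form is nonpositive everywhere; its isotropic vectors lie in the trivial kernel.\<close>

lemma neg_def_if_nonpos_onto:
  fixes M :: "complex^'r^'r"
  assumes herm: "hermitian M" and onto: "\<And>v. \<exists>z. M *v z = v \<and> Re (sip z (M *v z)) \<le> 0"
  shows "neg_def M"
proof -
  have "\<exists>N. M ** N = mat 1"
    unfolding matrix_right_invertible_surjective surj_def using onto by metis
  then have inj: "x = 0" if "M *v x = 0" for x
    using that by (simp add: invertible_iff_inj flip: invertible_right_inverse)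
  have nonpos: "Re (sip x (M *v x)) \<le> 0" for x
  proof -
    obtain z where z: "M *v z = M *v x" "Re (sip z (M *v z)) \<le> 0" using onto by blast
    then have "z = x" using inj[of "z - x"] by (simp add: matrix_vector_mult_diff_distrib)
    then show ?thesis using z(2) by simp
  qed
  have "Re (sip x (M *v x)) < 0" if x: "x \<noteq> 0" for x
  proof (rule ccontr)
    assume "\<not> Re (sip x (M *v x)) < 0"
    then have z: "Re (sip x (M *v x)) = 0" using nonpos[of x] by simp
    \<comment> \<open>Varying \<open>x\<close> along \<open>M *v x\<close> makes the derivative of
      the form twice the squared norm of \<open>M *v x\<close>.\<close>
    define v where "v = M *v x"
    have sym: "Re (sip x (M *v v)) = Re (sip v (M *v x))" using hermitian_sip[OF herm, of x v] by simp
    have "- (2 * Re (sip v (M *v x))) = 0"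
    proof (rule linear_term_eq_0)
      fix t :: real
      let ?y = "x + of_real t *s v"
      have "sip ?y (M *v ?y) = sip x (M *v x) + of_real t * (sip x (M *v v) + sip v (M *v x)) + of_real (t\<^sup>2) * sip v (M *v v)"
        by (simp add: sip_simps matrix_vector_right_distrib matrix_vector_mult_scale algebra_simps power2_eq_square)
      then have "Re (sip ?y (M *v ?y)) = t * (2 * Re (sip v (M *v x))) + t\<^sup>2 * Re (sip v (M *v v))"
        using z sym by (simp del: of_real_power)
      then show "0 \<le> - (2 * Re (sip v (M *v x))) * t + (- Re (sip v (M *v v))) * t\<^sup>2"
        using nonpos[of ?y] by (simp add: algebra_simps)
    qed
    then have "Re (sip v v) = 0" by (simp add: v_def)
    then have "sip v v = 0" unfolding sip_self by simp
    then have "v = 0" by (simp add: sip_self_eq_0)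
    then show False using inj x by (simp add: v_def)
  qed
  then show ?thesis using herm by (simp add: neg_def_def herm_form_sip)
qed

section \<open>The two implications for the feedback loop\<close>

locale feedback_loop =
  plant: ni_double_integrator G A B C + controller: sni_system H A' B' C' D'
  for G H :: "complex \<Rightarrow> complex^'m^'m"
    and A :: "real^'n^'n" and B :: "real^'m^'n" and C :: "real^'n^'m"
    and A' :: "real^'k^'k" and B' :: "real^'m^'k" and C' :: "real^'k^'m" and D' :: "real^'m^'m" +
  fixes J :: "real^'r^'m"
  assumes null: "null_space (coeff2 G) \<subseteq> null_space (transpose (coeff0 G))"
    and coeff2: "coeff2 G = cmat (J ** transpose J)"
    and rank: "rank J = CARD('r)"
begin

abbreviation loop :: "real^('n + 'k)^('n + 'k)" where
  "loop \<equiv> closed_loop_matrix A B C 0 A' B' C' D'"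

abbreviation dc :: "complex^'r^'r" where
  "dc \<equiv> transpose (cmat J) ** H 0 ** cmat J"

lemma dc_mult: "dc *v z = ctranspose (cmat J) *v (H 0 *v (cmat J *v z))"
  by (simp only: transpose_cmat_eq matrix_vector_mul_assoc matrix_mul_assoc)

lemma sip_dc: "sip w (dc *v z) = sip (cmat J *v w) (H 0 *v (cmat J *v z))"
  by (simp only: dc_mult sip_ctranspose_right)

lemma dc_hermitian: "hermitian dc"
proof (rule hermitian_real_form)
  fix x
  have "sip x (dc *v x) = cnj (sip x (dc *v x))"
    unfolding sip_dc using hermitian_sip[OF controller.hermitian_dc] .
  then show "Im (sip x (dc *v x)) = 0" by (metis cnj.sel(2) equal_neg_zero)
qed

lemma coeff2_mult: "coeff2 G *v x = cmat J *v (ctranspose (cmat J) *v x)"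
  unfolding coeff2 by (simp only: cmat_mult ctranspose_cmat matrix_vector_mul_assoc)

lemma coeff2_eq_0:
  assumes "coeff2 G *v u = 0"
  shows "ctranspose (cmat J) *v u = 0"
proof -
  have "sip u (coeff2 G *v u) = 0" using assms by (simp add: sip_simps)
  then show ?thesis
    unfolding coeff2_mult sip_ctranspose[of u "cmat J"] by (simp only: sip_self_eq_0)
qed

text \<open>The hypothesis uses the transpose, the inner product the conjugate transpose. As
  \<open>coeff2 G\<close> is real, its null space is closed under conjugation, which bridges the
  two.\<close>

lemma null_direction:
  assumes w: "coeff2 G *v w = 0"
  shows "ni_null_direction G A B C w"
proof
  show "coeff2 G *v w = 0" by (rule w)
  show "hermitian (coeff0 G)" by (rule plant.coeff0_hermitian[OF coeff2])
  fix u
  have "coeff2 G *v vcnj w = vcnj (coeff2 G *v w)" unfolding coeff2 by (rule cmat_vcnj)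
  then have "coeff2 G *v vcnj w = 0" using w by (simp add: vec_eq_iff)
  then have "transpose (coeff0 G) *v vcnj w = 0" using null unfolding null_space_def by blast
  moreover have "ctranspose (coeff0 G) *v w = vcnj (transpose (coeff0 G) *v vcnj w)"
    by (simp add: vec_eq_iff matrix_vector_mult_def vector_matrix_mult_def ctranspose_def transpose_def mult.commute)
  ultimately have "ctranspose (coeff0 G) *v w = 0" by (simp add: vec_eq_iff)
  then show "sip w (coeff0 G *v u) = 0" unfolding sip_ctranspose[of w "coeff0 G"] by (simp add: sip_simps)
qed

text \<open>J K \<open>J\<^sup>T\<close> is the orthogonal projection onto the range of
  \<open>J\<close>; the remainder \<open>w\<close> of \<open>y\<close> is killed by
  \<open>coeff2 G\<close>, hence orthogonal to \<open>y\<close> and to itself.\<close>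

lemma in_range_J:
  assumes "\<And>w. coeff2 G *v w = 0 \<Longrightarrow> sip w y = 0"
  obtains z where "y = cmat J *v z"
proof -
  obtain K :: "complex^'r^'r" where
    K: "\<And>x. ctranspose (cmat J) *v (cmat J *v (K *v x)) = x"
    using full_column_rank_right_inverse[OF rank] by blast
  define z where "z = K *v (ctranspose (cmat J) *v y)"
  define w where "w = y - cmat J *v z"
  have Tw: "ctranspose (cmat J) *v w = 0"
    unfolding w_def z_def matrix_vector_mult_diff_distrib K by simp
  then have "sip w y = 0" by (intro assms) (simp add: coeff2_mult)
  moreover have "sip w (cmat J *v z) = 0"
    unfolding sip_ctranspose[of w "cmat J"] Tw by (simp add: sip_simps)
  ultimately have "sip w (y - cmat J *v z) = 0" by (simp add: sip_simps)
  then have "sip w w = 0" by (simp only: w_def)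
  then have "y = cmat J *v z" by (simp add: sip_self_eq_0 w_def)
  then show ?thesis by (rule that)
qed

lemma stable_if_neg_def:
  assumes neg: "neg_def dc"
  shows "hurwitz loop"
  unfolding hurwitz_iff
proof (rule ballI, rule ccontr)
  fix l assume l: "l \<in> eigs loop" "\<not> Re l < 0"
  obtain v where v: "v \<noteq> 0" "cmat loop *v v = l *s v" using l(1) by (auto simp: eigs_iff)
  define x where "x = vec_Inl v"
  define x' where "x' = vec_Inr v"
  define y where "y = cmat C *v x"
  define u where "u = cmat D' *v y + cmat C' *v x'"
  have ex: "l *s x = cmat A *v x + cmat B *v u"
    using arg_cong[OF v(2), of vec_Inl] by (simp add: closed_loop_mult vec_sum_simps x_def x'_def y_def u_def)
  have "l *s x' = cmat A' *v x' + cmat B' *v y"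
    using arg_cong[OF v(2), of vec_Inr] by (simp add: closed_loop_mult vec_sum_simps x_def x'_def y_def add.commute)
  moreover have l': "l \<notin> eigs A'" using l(2) by (intro controller.no_eigs) simp
  ultimately have x': "x' = resv A' l (cmat B' *v y)" by (intro resv_unique)
  then have u: "u = H l *v y"
    by (simp add: u_def realization_apply[OF controller.real l'] add.commute)
  \<comment> \<open>A mode with zero output would be an unobservable mode of the plant.\<close>
  have "y \<noteq> 0"
  proof
    assume y: "y = 0"
    then have "x' = 0" "u = 0" using x' u by (simp_all add: resv_simps)
    then have "cmat A *v x = l *s x" using ex by simp
    then have "x = 0" using minimal_unobservable_eigenvector[OF plant.minimal] y by (simp add: y_def)
    then show False using v(1) \<open>x' = 0\<close> by (simp add: vec_sum_eq_0_iff x_def x'_def)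
  qed
  have neg': "Re (sip y (H 0 *v y)) < 0" if "y = cmat J *v z" for z
  proof -
    have "z \<noteq> 0" using \<open>y \<noteq> 0\<close> that by auto
    then have "Re (sip z (dc *v z)) < 0" using neg by (simp add: neg_def_def herm_form_sip)
    then show ?thesis using that by (simp only: sip_dc)
  qed
  consider "Re l > 0" | "Re l = 0" "l \<noteq> 0" | "l = 0" using l(2) by force
  then show False
  proof cases
    case 1
    have "x = resv A l (cmat B *v u)" using ex by (intro resv_unique plant.no_eigs 1)
    then have y: "y = G l *v u" by (simp add: y_def plant.G_apply[OF plant.no_eigs[OF 1]])
    obtain z where "y = cmat J *v z"
      by (rule in_range_J[of y]) (simp only: y ni_null_direction.left_zero[OF null_direction 1])
    then have "Re (sip y (H 0 *v y)) < 0" by (rule neg')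
    then have "Re l * Re (sip y (H 0 *v y)) < 0" using 1 by (intro mult_pos_neg)
    moreover have "Im (sip y (H 0 *v y)) = 0"
      using hermitian_sip[OF controller.hermitian_dc, of y y] by (metis cnj.sel(2) equal_neg_zero)
    moreover have "Re ((sip y (H 0 *v y) - sip y u) / l) \<ge> 0"
      unfolding u by (rule controller.positive_real_quotient[OF 1])
    moreover have "Re (l * sip u y) \<ge> 0" using plant.positive_real[OF 1, of u] by (simp add: y)
    moreover have "(Re l)\<^sup>2 + (Im l)\<^sup>2 > 0" using 1 by (simp add: sum_power2_gt_zero_iff)
    \<comment> \<open>Clearing the denominator gives
      \<open>Re l * Re (sip y (H 0 *v y)) \<ge> Re (l * sip u y) \<ge> 0\<close>, while the left
      side is negative.\<close>
    ultimately show False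
      unfolding cnj_sip[of u y, symmetric]
      by (simp add: Re_divide zero_le_divide_iff algebra_simps)
  next
    case 2
    have "Re (l * sip u y) \<ge> 0" unfolding y_def by (rule plant.axis_state_nonneg[OF 2 ex])
    moreover have "Re (l * sip y u) > 0" unfolding u by (rule controller.axis_pos[OF 2 \<open>y \<noteq> 0\<close>])
    \<comment> \<open>For imaginary \<open>l\<close>, conjugating the inner product flips the sign
      of the real part, so the two inequalities clash.\<close>
    ultimately show False using 2 by (simp flip: cnj_sip[of u y])
  next
    case 3
    have ex0: "cmat A *v x + cmat B *v u = 0" using ex 3 by simp
    obtain z where z: "y = cmat J *v z"
      by (rule in_range_J[of y]) (simp only: y_def ni_null_direction.left_zero_state[OF null_direction ex0])
    have "ctranspose (cmat J) *v u = 0" by (rule coeff2_eq_0[OF plant.coeff2_input_zero[OF ex0]])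
    then have "sip y u = 0" unfolding z sip_ctranspose_right[symmetric] by (simp add: sip_simps)
    then show False using neg'[OF z] by (simp add: u 3)
  qed
qed

lemma stable_imp_dc_nonpos:
  assumes stable: "hurwitz loop"
  shows "\<exists>z. dc *v z = - (ctranspose (cmat J) *v r) \<and> Re (sip z (dc *v z)) \<le> 0"
proof -
  have no_eigs: "s \<notin> eigs loop" if "Re s \<ge> 0" for s
    using stable that unfolding hurwitz_iff by force
  define b :: "complex^('n + 'k)" where "b = inject_Inl (cmat B *v r)"
  define out :: "complex^('n + 'k)^'m" where "out = cmat C ** project_Inl"
  \<comment> \<open>The response of the plant output to an external \<open>r\<close> added to the
    plant input.\<close>
  define T where "T = (\<lambda>s. out *v resv loop s b)"
  have out: "out *v v = cmat C *v vec_Inl v" for v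
    by (simp add: out_def project_Inl_mult flip: matrix_vector_mul_assoc)
  have loop_eq: "\<exists>x. s *s x = cmat A *v x + cmat B *v (H s *v T s + r) \<and> T s = cmat C *v x" if s: "Re s \<ge> 0" for s
  proof -
    let ?v = "resv loop s b"
    have v: "s *s ?v = cmat loop *v ?v + b" using resv_eq(1)[OF no_eigs[OF s], of b] by simp
    have "s *s vec_Inr ?v = cmat A' *v vec_Inr ?v + cmat B' *v T s"
      using arg_cong[OF v, of vec_Inr] by (simp add: closed_loop_mult vec_sum_simps T_def out b_def)
    then have "vec_Inr ?v = resv A' s (cmat B' *v T s)" by (intro resv_unique controller.no_eigs s)
    then have "cmat D' *v T s + cmat C' *v vec_Inr ?v = H s *v T s"
      by (simp add: realization_apply[OF controller.real controller.no_eigs[OF s]] add.commute)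
    moreover have "s *s vec_Inl ?v = cmat A *v vec_Inl ?v + cmat B *v (cmat D' *v T s + cmat C' *v vec_Inr ?v + r)"
      using arg_cong[OF v, of vec_Inl]
      by (simp add: closed_loop_mult vec_sum_simps T_def out b_def matrix_vector_right_distrib)
    ultimately show ?thesis by (auto simp: T_def out)
  qed
  have T_lim: "(T \<longlongrightarrow> T p) (at p)" if "Re p \<ge> 0" for p
    unfolding T_def by (intro tendsto_matrix_vector_mult resv_tendsto no_eigs that)
  have pos: "Re (s * sip r (T s)) \<ge> 0" if s: "Re s > 0" for s
  proof (rule Re_nonneg_right_half_plane[where f = "\<lambda>s. s * sip r (T s)" and S = "eigs loop \<union> eigs A" and L = "sip r (out *v b)"])
    show "(\<lambda>s. s * sip r (T s)) holomorphic_on - (eigs loop \<union> eigs A)"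
      unfolding T_def by (intro holomorphic_intros holomorphic_on_subset[OF sip_resv_holomorphic]) auto
    show "closed (eigs loop \<union> eigs A)" by (intro closed_Un closed_eigs)
    show "\<forall>\<^sub>F s in at p. s \<notin> eigs loop \<union> eigs A" for p
      using eigs_eventually_at[of loop p] eigs_eventually_at[of A p] by eventually_elim simp
    show "\<forall>\<^sub>F s in at_infinity. s \<notin> eigs loop \<union> eigs A"
      using eigs_eventually_at_infinity[of loop] eigs_eventually_at_infinity[of A] by eventually_elim simp
    show "s \<notin> eigs loop \<union> eigs A" if "Re s > 0" for s
      using that no_eigs[of s] plant.no_eigs[of s] by simp
    show "Re (s * sip r (T s)) \<ge> 0" if s: "Re s = 0" "s \<notin> eigs loop \<union> eigs A" for s
    proof (cases "s = 0")
      case False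
      obtain x where x: "s *s x = cmat A *v x + cmat B *v (H s *v T s + r)" "T s = cmat C *v x"
        using loop_eq[of s] s by auto
      \<comment> \<open>The plant inequality is for the total input. On the axis the controller's
        share of it has the opposite sign, so the share of \<open>r\<close> is nonnegative.\<close>
      have "Re (s * sip (H s *v T s + r) (T s)) \<ge> 0"
        unfolding x(2) using x by (intro plant.axis_state_nonneg s(1) False) simp
      moreover have "Re (s * sip (T s) (H s *v T s)) \<ge> 0" by (rule controller.axis_nonneg[OF s(1) False])
      ultimately show ?thesis
        using s(1) by (simp add: sip_simps algebra_simps flip: cnj_sip[of "T s" "H s *v T s"])
    qed simp
    show "\<exists>k::real. k \<ge> 0 \<and> ((\<lambda>s. (s - p) * (s * sip r (T s))) \<longlongrightarrow> of_real k) (at p)" if p: "Re p = 0" for p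
    proof (intro exI[of _ 0] conjI)
      have "((\<lambda>s. (s - p) * (s * sip r (T s))) \<longlongrightarrow> (p - p) * (p * sip r (T p))) (at p)"
        by (intro tendsto_intros T_lim) (simp add: p)
      then show "((\<lambda>s. (s - p) * (s * sip r (T s))) \<longlongrightarrow> of_real 0) (at p)" by simp
    qed simp
    show "((\<lambda>s. s * sip r (T s)) \<longlongrightarrow> sip r (out *v b)) at_infinity"
      using tendsto_sip[OF tendsto_const[of r] tendsto_matrix_vector_mult[OF scaled_resv_tendsto_at_infinity[of loop b], of out]]
      by (simp add: T_def matrix_vector_mult_scale sip_simps)
  qed (rule s)
  have lim: "filterlim (\<lambda>t::real. complex_of_real t) (at 0) (at_right 0)"
  proof (rule filterlim_atI)
    have "((\<lambda>t::real. complex_of_real t) \<longlongrightarrow> of_real 0) (at_right 0)" by (intro tendsto_intros)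
    then show "((\<lambda>t::real. complex_of_real t) \<longlongrightarrow> 0) (at_right 0)" by simp
    show "\<forall>\<^sub>F t in at_right (0::real). complex_of_real t \<noteq> 0" by (auto simp: eventually_at_filter)
  qed
  \<comment> \<open>For positive real \<open>s\<close> the factor \<open>s\<close> can be divided
    out before passing to 0.\<close>
  have T0: "Re (sip r (T 0)) \<ge> 0"
  proof (rule tendsto_lowerbound[OF _ _ trivial_limit_at_right_real])
    show "((\<lambda>t::real. Re (sip r (T (of_real t)))) \<longlongrightarrow> Re (sip r (T 0))) (at_right 0)"
      by (intro tendsto_Re tendsto_sip tendsto_const filterlim_compose[OF T_lim lim]) simp
    have "\<forall>\<^sub>F t in at_right (0::real). t > 0" by (simp add: eventually_at_filter)
    then show "\<forall>\<^sub>F t in at_right (0::real). Re (sip r (T (of_real t))) \<ge> 0"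
    proof eventually_elim
      case (elim t)
      then show ?case using pos[of "of_real t"] by (simp add: zero_le_mult_iff)
    qed
  qed
  obtain x where x: "0 *s x = cmat A *v x + cmat B *v (H 0 *v T 0 + r)" "T 0 = cmat C *v x"
    using loop_eq[of 0] by auto
  from x(1) have x0: "cmat A *v x + cmat B *v (H 0 *v T 0 + r) = 0" by simp
  obtain z where z: "T 0 = cmat J *v z"
    by (rule in_range_J[of "T 0"]) (simp only: x(2) ni_null_direction.left_zero_state[OF null_direction x0])
  have "ctranspose (cmat J) *v (H 0 *v T 0 + r) = 0"
    by (rule coeff2_eq_0[OF plant.coeff2_input_zero[OF x0]])
  then have eq: "dc *v z = - (ctranspose (cmat J) *v r)"
    by (simp only: dc_mult z matrix_vector_right_distrib eq_neg_iff_add_eq_0)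
  have "sip r (T 0) = cnj (sip z (ctranspose (cmat J) *v r))"
    unfolding z sip_ctranspose_right cnj_sip ..
  also have "ctranspose (cmat J) *v r = - (dc *v z)" by (simp only: eq minus_minus)
  finally have "Re (sip z (- (dc *v z))) \<ge> 0" using T0 by simp
  moreover have "sip z (- (dc *v z)) = - sip z (dc *v z)" by (simp add: sip_def sum_negf)
  ultimately show ?thesis using eq by (intro exI[of _ z]) simp
qed

lemma neg_def_if_stable:
  assumes "hurwitz loop"
  shows "neg_def dc"
proof (rule neg_def_if_nonpos_onto, rule dc_hermitian)
  fix v
  obtain K :: "complex^'r^'r" where
    K: "\<And>x. ctranspose (cmat J) *v (cmat J *v (K *v x)) = x"
    using full_column_rank_right_inverse[OF rank] by blast
  \<comment> \<open>The input \<open>r\<close> is chosen with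
    \<open>- (ctranspose (cmat J) *v r) = v\<close>.\<close>
  obtain z where "dc *v z = - (ctranspose (cmat J) *v (cmat J *v (K *v (- v))))" "Re (sip z (dc *v z)) \<le> 0"
    using stable_imp_dc_nonpos[OF assms, of "cmat J *v (K *v (- v))"] by blast
  then show "\<exists>z. dc *v z = v \<and> Re (sip z (dc *v z)) \<le> 0"
    unfolding K by (intro exI[of _ z]) simp
qed

end

theorem theorem2:
  fixes G G' :: "complex \<Rightarrow> complex^'m^'m"
    and A :: "real^'n^'n" and B :: "real^'m^'n" and C :: "real^'n^'m" and D :: "real^'m^'m"
    and A' :: "real^'k^'k" and B' :: "real^'m^'k" and C' :: "real^'k^'m" and D' :: "real^'m^'m"
    and J :: "real^'r^'m"
  assumes "minimal_realization G A B C D"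
    and "minimal_realization G' A' B' C' D'"
    and "strictly_negative_imaginary G'"
    and "D = 0"
    and "negative_imaginary G"
    and "coeff1 G = 0"
    and "coeff2 G \<noteq> 0"
    and "null_space (coeff2 G) \<subseteq> null_space (transpose (coeff0 G))"
    and "coeff2 G = cmat (J ** transpose J)"
    and "rank J = CARD('r)"
  shows "internally_stable A B C D A' B' C' D' \<longleftrightarrow>
         neg_def (transpose (cmat J) ** G' 0 ** cmat J)"
proof -
  interpret feedback_loop G G' A B C A' B' C' D' J
    using assms by unfold_locales simp_all
  \<comment> \<open>Strict properness makes the loop well posed.\<close>
  have "invertible (mat 1 - D ** D')"
    using \<open>D = 0\<close> by (simp add: invertible_iff_inj)
  then show ?thesis
    unfolding internally_stable_def using stable_if_neg_def neg_def_if_stable \<open>D = 0\<close> by blast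
qed

end
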